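(* Let $A\in\mathbb{R}^{N\times N}$ satisfy $F(A)\subset\mathbb{C}^{+}$, let $b\in\mathbb{R}^N$, $b\neq 0$, let $\lambda>0$, and put $Z=(A+\lambda I)^{-1}$ and $f(z)=(1-\lambda z)^{-1}z$, so that $x:=A^{-1}b=f(Z)b$. Let $\Omega\subset\mathbb{C}$ be an ellipse (with associated conformal mapping $\psi$, and inverse $\phi$), symmetric with respect to the real axis and such that $F(Z)\subseteq\Omega$, with $f$ analytic in $\Omega$. Let $x_m$ be the $m$-th Arnoldi approximation to $f(Z)b$ and $E_m=x-x_m$. Then, for $m$ large enough, we have $$\|E_m\|\le 4\,e\,C\,\frac{\widehat r}{\widehat r-1}\,\frac{1}{\psi'(\widehat r)}\,K\,\frac{m+1}{\widehat r^{\,m}},$$ where $K=1/\lambda^{2}$, $\widehat r=\phi(1/\lambda)$, and $C=11.08$ ($C=1$ if $A$ is symmetric).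
   Context: Norms are Euclidean. $F(M)=\{x^HMx/x^Hx : x\in\mathbb{C}^N\setminus\{0\}\}$ is the field of values of a matrix $M$; $\mathbb{C}^+$ is the open right half plane $\{z:\mathrm{Re}\,z>0\}$; $e$ in the bound is Euler's number. Ellipse and conformal mapping: $\Omega$ is a compact (filled) ellipse. The conformal mapping associated with $\Omega$ is the conformal surjection $\psi:\overline{\mathbb{C}}\setminus\{w:|w|\le1\}\to\overline{\mathbb{C}}\setminus\Omega$ with $\psi(\infty)=\infty$ and $\psi'(\infty)=\gamma$, where $\gamma$ is the capacity of $\Omega$. For an ellipse it has the form $\psi(w)=\gamma w+c_0+c_1/w$. Its inverse is $\phi=\psi^{-1}$. The only singularity of $f$ is at $1/\lambda$. Arnoldi approximation: let $K_m(Z,b)=\mathrm{span}\{b,Zb,\dots,Z^{m-1}b\}$. The Arnoldi algorithm produces an orthonormal sequence $v_1,v_2,\dots$ with $v_1=b/\|b\|$ and $\mathrm{span}\{v_1,\dots,v_m\}=K_m(Z,b)$. Put $V_m=[v_1,\dots,v_m]$ and let $H_m=V_m^TZV_m$, the upper Hessenberg matrix with entries $h_{i,j}=v_i^TZv_j$. The $m$-th Arnoldi approximation to $x=f(Z)b$ is $x_m=\|b\|\,V_mf(H_m)e_1$, where $e_1$ is the first vector of the canonical basis of $\mathbb{R}^m$. *)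

theory Defs
  imports
    "HOL-Complex_Analysis.Complex_Analysis"
    "Jordan_Normal_Form.VS_Connect"
    "Jordan_Normal_Form.Gauss_Jordan_Elimination"
begin

no_notation Finite_Cartesian_Product.vec_nth (infixl \<open>$\<close> 90)
no_notation Inner_Product.real_inner_class.inner (infix \<open>\<bullet>\<close> 70)

definition euclid_norm :: "real vec \<Rightarrow> real" where
  "euclid_norm v = sqrt (v \<bullet> v)"

definition field_of_values :: "complex mat \<Rightarrow> complex set" where
  "field_of_values M =
     {((M *\<^sub>v x) \<bullet>c x) / (x \<bullet>c x) | x. x \<in> carrier_vec (dim_row M) \<and> x \<noteq> 0\<^sub>v (dim_row M)}"

(* Only meaningful for invertible M. *)
definition minv :: "real mat \<Rightarrow> real mat" where
  "minv M = the (mat_inverse M)"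

definition f_fun :: "real \<Rightarrow> complex \<Rightarrow> complex" where
  "f_fun lam z = inverse (1 - of_real lam * z) * z"

(* The same rational function evaluated at a square matrix. *)
definition f_mat :: "real \<Rightarrow> real mat \<Rightarrow> real mat" where
  "f_mat lam M = minv (1\<^sub>m (dim_row M) - lam \<cdot>\<^sub>m M) * M"

(* Sum of the distances to two foci p and q (possibly equal: a disc) at most the major axis;
   the strict inequality excludes segments and points. *)
definition filled_ellipse :: "complex set \<Rightarrow> bool" where
  "filled_ellipse \<Omega> \<longleftrightarrow> (\<exists>p q a. dist p q < 2 * a \<and> \<Omega> = {z. dist z p + dist z q \<le> 2 * a})"

(* The finite part of the conformal surjection between the two exterior domains in the Riemann
   sphere.  The limit clause encodes both psi(infinity) = infinity and psi'(infinity) = gamma;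
   a conformal map of this kind with gamma > 0 is unique, and gamma is then the
   (logarithmic) capacity of Omega. *)
definition exterior_conformal_map :: "complex set \<Rightarrow> (complex \<Rightarrow> complex) \<Rightarrow> bool" where
  "exterior_conformal_map \<Omega> \<psi> \<longleftrightarrow>
     \<psi> holomorphic_on {w. 1 < norm w} \<and>
     inj_on \<psi> {w. 1 < norm w} \<and>
     \<psi> ` {w. 1 < norm w} = - \<Omega> \<and>
     (\<exists>\<gamma>::real. 0 < \<gamma> \<and> ((\<lambda>w. \<psi> w / w) \<longlongrightarrow> complex_of_real \<gamma>) at_infinity)"

definition exterior_inverse :: "(complex \<Rightarrow> complex) \<Rightarrow> complex \<Rightarrow> complex" where
  "exterior_inverse \<psi> = inv_into {w. 1 < norm w} \<psi>"

definition vec_span :: "nat \<Rightarrow> real vec set \<Rightarrow> real vec set" where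
  "vec_span N S = LinearCombinations.module.span class_ring (module_vec TYPE(real) N) S"

definition krylov :: "real mat \<Rightarrow> real vec \<Rightarrow> nat \<Rightarrow> real vec set" where
  "krylov Z b k = vec_span (dim_vec b) {(Z ^\<^sub>m j) *\<^sub>v b | j. j < k}"

(* The columns of V are the first m Arnoldi vectors v_1, ..., v_m (v_{j+1} = col V j).
   They exist exactly as long as the algorithm has not broken down, i.e. dim (krylov Z b m) = m,
   and are unique up to signs, which do not affect the approximation below. *)
definition arnoldi_basis :: "real mat \<Rightarrow> real vec \<Rightarrow> nat \<Rightarrow> real mat \<Rightarrow> bool" where
  "arnoldi_basis Z b m V \<longleftrightarrow>
     0 < m \<and> V \<in> carrier_mat (dim_vec b) m \<and>
     transpose_mat V * V = 1\<^sub>m m \<and>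
     col V 0 = (1 / euclid_norm b) \<cdot>\<^sub>v b \<and>
     (\<forall>k\<in>{1..m}. vec_span (dim_vec b) {col V j | j. j < k} = krylov Z b k)"

definition arnoldi_approx :: "(real mat \<Rightarrow> real mat) \<Rightarrow> real mat \<Rightarrow> real vec \<Rightarrow> real mat \<Rightarrow> real vec" where
  "arnoldi_approx f Z b V =
     (let H = transpose_mat V * Z * V
      in euclid_norm b \<cdot>\<^sub>v (V *\<^sub>v (f H *\<^sub>v unit_vec (dim_col V) 0)))"

(* Conventions of the error bound.  The threshold hidden in "m large enough" depends only on lam, Omega and the norm beta of b, not
   on N, A or b: a threshold allowed to depend on N would make the claim void, since the Arnoldi
   process stops after at most N steps.  The norm enters because the bound, unlike the error, does
   not scale with b.  By symmetry of Omega, phi(1/lam) and psi'(phi(1/lam)) are real, so that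
   taking real parts only changes the type. *)

end

theory Submission
  imports Defs
begin

text \<open>The right-hand side decays like $m\,\hat r^{-m}$ and the threshold for $m$ may depend on
  \<open>lam\<close>, \<open>\<Omega>\<close> and \<open>\<beta>\<close>, so an error bound $O(\hat r^{-m})$ that is uniform in \<open>N\<close>, \<open>A\<close>
  and \<open>b\<close> suffices. By the Schwarz lemma $\psi(w) = \gamma (w + G/w) + c$ with real $\gamma$, $G$,
  $c$ and $|G| < 1$. Put $T = (Z - cI)/\gamma$ and let $D_m$ be the Dickson polynomials,
  $D_m(w + G/w) = w^m + (G/w)^m$; up to scaling they are the Faber polynomials of \<open>\<Omega>\<close>. The
  numerical radius of $D_m(T)$ is at most 2, hence $\|D_m(T)\| \le 8$.

  Since $f(z) = ((1 - \lambda z)^{-1} - 1)/\lambda$, the error is that of a Galerkin approximation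
  in the Krylov space for the matrix $B = I - \lambda Z$, whose quadratic form is bounded away from 0
  on real unit vectors because $1/\lambda \notin \Omega$. By Cea's lemma the error is controlled by
  the residual of any element of the Krylov space; interpolation of $(1 - \lambda z)^{-1}$ with
  residual polynomial $D_m((z - c)/\gamma) / D_m(\hat r + G/\hat r)$ makes it $O(\hat r^{-m})$.

  Symmetry of \<open>\<Omega>\<close> makes $\hat r$ real; it is positive since \<open>\<Omega>\<close> is convex and, \<open>A\<close>
  being accretive, $F(Z)$ contains a real number smaller than $1/\lambda$.\<close>

subsection \<open>Dickson polynomials and the numerical range\<close>

text \<open>Dickson polynomials of the first kind; for \<open>G = 1\<close> they are the Chebyshev
  polynomials 2 T_n(x/2). The initial value 2 makes the closed form w^n + (G/w)^n hold for n = 0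
  too. The ring is generic because both the real and the complex instance occur below.\<close>

fun dickson :: "'a::comm_ring_1 \<Rightarrow> nat \<Rightarrow> 'a poly" where
  "dickson G 0 = [:2:]"
| "dickson G (Suc 0) = [:0, 1:]"
| "dickson G (Suc (Suc n)) = pCons 0 (dickson G (Suc n)) - Polynomial.smult G (dickson G n)"

text \<open>At x = w + G/w the characteristic equation of the recurrence has the roots w and G/w,
  with sum x and product G.\<close>

lemma poly_dickson:
  fixes w :: "'a::field"
  assumes "w \<noteq> 0"
  shows "poly (dickson G n) (w + G / w) = w ^ n + (G / w) ^ n"
proof (induction G n rule: dickson.induct)
  case (3 G n)
  define b where "b = G / w"
  have G: "G = w * b" using assms by (simp add: b_def)
  show ?case
    using 3 by (simp flip: b_def) (simp add: G algebra_simps)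
qed auto

lemma degree_dickson_le: "degree (dickson G n) \<le> n"
proof (induction G n rule: dickson.induct)
  case (3 G n)
  have "degree (pCons 0 (dickson G (Suc n))) \<le> Suc (Suc n)"
    using 3(1) by (metis Suc_le_mono degree_pCons_le le_trans)
  moreover have "degree (Polynomial.smult G (dickson G n)) \<le> Suc (Suc n)"
    using 3(2) degree_smult_le[of G "dickson G n"] by linarith
  ultimately show ?case by (simp add: degree_diff_le)
qed auto

text \<open>This is the chain rule for the closed form in w, multiplied by w. It avoids division by
  w - G/w, so it also covers w^2 = G, and induction along the recurrence proves it over any
  field.\<close>

lemma poly_pderiv_dickson:
  fixes w :: "'a::field"
  assumes "w \<noteq> 0"
  shows "(w - G / w) * poly (pderiv (dickson G n)) (w + G / w) = of_nat n * (w ^ n - (G / w) ^ n)"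
proof (induction G n rule: dickson.induct)
  case (3 G n)
  define b where "b = G / w"
  have G: "G = w * b" using assms by (simp add: b_def)
  have "(w - b) * poly (pderiv (dickson G (Suc (Suc n)))) (w + b)
      = (w - b) * (w ^ Suc n + b ^ Suc n)
        + (w + b) * ((w - b) * poly (pderiv (dickson G (Suc n))) (w + b))
        - G * ((w - b) * poly (pderiv (dickson G n)) (w + b))"
    using poly_dickson[OF assms, of G "Suc n"]
    by (simp add: pderiv_pCons pderiv_diff pderiv_smult algebra_simps flip: b_def)
  also have "\<dots> = (w - b) * (w ^ Suc n + b ^ Suc n)
        + (w + b) * (of_nat (Suc n) * (w ^ Suc n - b ^ Suc n)) - G * (of_nat n * (w ^ n - b ^ n))"
    using 3 by (simp flip: b_def del: of_nat_Suc)
  also have "\<dots> = of_nat (Suc (Suc n)) * (w ^ Suc (Suc n) - b ^ Suc (Suc n))"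
    by (simp add: G algebra_simps)
  finally show ?case unfolding b_def .
qed (auto simp: pderiv_pCons)

text \<open>Two preimages of one point either agree or have product \<open>G\<close>, which the norm
  condition excludes.\<close>

lemma joukowski_inj:
  fixes w v G :: complex
  assumes "w + G / w = v + G / v" "w \<noteq> 0" "v \<noteq> 0" "norm G < norm w * norm v"
  shows "w = v"
proof -
  have "(w - v) * (w * v - G) = 0"
    using assms(1-3) by (simp add: field_simps)
  moreover have "w * v \<noteq> G" using assms(4) by (metis norm_mult order_less_irrefl)
  ultimately show ?thesis by auto
qed

text \<open>The factor theorem gives \<open>Q\<close>; differentiating the product at
  \<open>a\<close> gives its value there.\<close>

lemma dickson_quotient:
  fixes a :: "'a::field"
  obtains Q where "[:- a, 1:] * Q = dickson G m - [:poly (dickson G m) a:]"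
    "poly Q a = poly (pderiv (dickson G m)) a" "degree Q \<le> m - 1"
proof -
  have "poly (dickson G m - [:poly (dickson G m) a:]) a = 0" by simp
  then obtain Q where Q: "dickson G m - [:poly (dickson G m) a:] = [:- a, 1:] * Q"
    by (metis dvdE poly_eq_0_iff_dvd)
  have "pderiv (dickson G m) = pderiv (dickson G m - [:poly (dickson G m) a:])"
    by (simp add: pderiv_pCons pderiv_diff)
  also have "\<dots> = pderiv ([:- a, 1:] * Q)" by (simp only: Q)
  also have "poly \<dots> a = poly Q a"
    by (subst pderiv_mult) (simp add: pderiv_pCons)
  finally have 2: "poly Q a = poly (pderiv (dickson G m)) a" ..
  have "degree Q \<le> m - 1"
  proof (cases "Q = 0")
    case False
    then have "degree ([:- a, 1:] * Q) = Suc (degree Q)" by (subst degree_mult_eq) auto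
    moreover have "degree (dickson G m - [:poly (dickson G m) a:]) \<le> m"
      by (rule degree_diff_le) (auto simp: degree_dickson_le)
    ultimately show ?thesis using Q by simp
  qed auto
  with that Q 2 show ?thesis by metis
qed

text \<open>The nodes w + G/w with w^m = s are m distinct points at which the Dickson polynomial has
  the common value s + G^m/s. So at each node only its own quotient survives, and the derivative
  formula turns that term into m(s - G^m/s). A polynomial of degree below m with one value at m
  points is constant.\<close>

lemma sum_dickson_quotients:
  fixes G s :: complex and Q :: "complex \<Rightarrow> complex poly"
  assumes m: "0 < m" and s: "norm s = 1" and G: "norm G < 1"
    and Q: "\<And>w. w ^ m = s \<Longrightarrow>
      [:- (w + G / w), 1:] * Q w = dickson G m - [:poly (dickson G m) (w + G / w):]"
    and Qd: "\<And>w. w ^ m = s \<Longrightarrow> poly (Q w) (w + G / w) = poly (pderiv (dickson G m)) (w + G / w)"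
    and deg: "\<And>w. w ^ m = s \<Longrightarrow> degree (Q w) \<le> m - 1"
  shows "(\<Sum>w | w ^ m = s. Polynomial.smult (w - G / w) (Q w)) = [:of_nat m * (s - G ^ m / s):]"
    (is "?S = _")
proof -
  let ?W = "{w. w ^ m = s}"
  have s0: "s \<noteq> 0" using s by auto
  have nW: "norm w = 1" "w \<noteq> 0" if "w \<in> ?W" for w
  proof -
    have "norm w ^ m = 1" using that s by (simp flip: norm_power)
    then show "norm w = 1" using m by (metis norm_ge_zero power_eq_imp_eq_base power_one zero_le_one)
    then show "w \<noteq> 0" by auto
  qed
  have cardW: "card ?W = m" using card_nth_roots[OF s0 m] .
  then have finW: "finite ?W" using m by (metis card.infinite less_irrefl)
  have inj: "inj_on (\<lambda>w. w + G / w) ?W"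
    by (rule inj_onI, erule joukowski_inj) (use nW G in auto)
  show ?thesis
  proof (rule poly_eqI_degree[where A = "(\<lambda>w. w + G / w) ` ?W"])
    fix a assume "a \<in> (\<lambda>w. w + G / w) ` ?W"
    then obtain w where w: "w \<in> ?W" "a = w + G / w" by auto
    have "(v - G / v) * poly (Q v) a = 0" if v: "v \<in> ?W - {w}" for v
    proof -
      have "poly (dickson G m) (v + G / v) = poly (dickson G m) a"
        using v w nW by (simp add: poly_dickson power_divide)
      then have "(a - (v + G / v)) * poly (Q v) a = 0"
        using arg_cong[OF Q[of v], of "\<lambda>p. poly p a"] v by (simp add: algebra_simps)
      moreover have "a \<noteq> v + G / v" using inj v w unfolding inj_on_def by auto
      ultimately show ?thesis by simp
    qed
    then have "(\<Sum>v\<in>?W - {w}. (v - G / v) * poly (Q v) a) = 0" by (intro sum.neutral) blast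
    then have "poly ?S a = (w - G / w) * poly (Q w) a"
      using finW w by (simp add: poly_sum sum.remove)
    also have "\<dots> = of_nat m * (s - G ^ m / s)"
      using poly_pderiv_dickson[of w G m] w nW Qd[of w] by (simp add: power_divide)
    finally show "poly ?S a = poly [:of_nat m * (s - G ^ m / s):] a" by simp
  next
    have "degree ?S \<le> m - 1"
      by (rule degree_sum_le[OF finW]) (use deg degree_smult_le in \<open>force intro: le_trans\<close>)
    then show "degree ?S < card ((\<lambda>w. w + G / w) ` ?W)"
      using m by (simp add: card_image[OF inj] cardW)
    show "degree [:of_nat m * (s - G ^ m / s):] < card ((\<lambda>w. w + G / w) ` ?W)"
      using m by (simp add: card_image[OF inj] cardW)
  qed
qed

text \<open>An analogue for ellipses of the power inequality for the numerical radius, proved as in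
  Pearcy's argument for the latter: on the roots $w$ of $w^m = s$ the polynomial
  \<open>dickson G m\<close> takes the same value at $w + G/w$, and the numerators of the partial
  fraction decomposition sum up to a constant.\<close>

lemma dickson_form_bound:
  fixes B :: "complex poly \<Rightarrow> complex poly \<Rightarrow> complex" and G b :: real
  assumes B_add: "\<And>p q r. B (p + q) r = B p r + B q r"
    and B_smult: "\<And>c p r. B (Polynomial.smult c p) r = c * B p r"
    and B_add': "\<And>p q r. B r (p + q) = B r p + B r q"
    and B_smult': "\<And>c p r. B r (Polynomial.smult c p) = cnj c * B r p"
    and G: "\<bar>G\<bar> < 1"
    and pos: "\<And>w p. norm w = 1 \<Longrightarrow>
       0 \<le> Re (cnj (w - of_real G / w) * B ([:w + of_real G / w, - 1:] * p) p)"
    and b: "B 1 1 = of_real b"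
    and m: "0 < m"
  shows "norm (B (dickson (of_real G) m) 1) \<le> 2 * b"
proof -
  define GG where "GG = complex_of_real G"
  define D where "D = dickson GG m"
  have nG: "norm GG < 1" using G by (simp add: GG_def)
  have B_0': "B r 0 = 0" for r using B_smult'[of r 0 0] by simp
  have B_sum': "B r (\<Sum>x\<in>A. f x) = (\<Sum>x\<in>A. B r (f x))" for r f and A :: "complex set"
    by (induction A rule: infinite_finite_induct) (auto simp: B_0' B_add')
  have B_uminus: "B (- p) r = - B p r" for p r using B_smult[of "-1" p r] by simp
  have B_diff: "B (p - q) r = B p r - B q r" for p q r
    using B_add[of p "-q" r] by (simp add: B_uminus)
  have Re_of_nat_mult: "Re (of_nat n * z) = real n * Re z" for n z by simp
  \<comment> \<open>The positivity hypothesis, taken at p = 1, passes to the Dickson polynomial,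
    with \<open>s\<close> in place of \<open>w\<close> and \<open>GG ^ m\<close> in place of
    \<open>GG\<close>.\<close>
  have key: "0 \<le> Re (cnj (s - GG ^ m / s) * ((s + GG ^ m / s) * of_real b - B D 1))"
    if s: "norm s = 1" for s
  proof -
    define W where "W = {w. w ^ m = s}"
    have nW: "norm w = 1" "w \<noteq> 0" if "w \<in> W" for w
    proof -
      have "norm w ^ m = 1" using that s by (simp add: W_def flip: norm_power)
      then show "norm w = 1" using m by (metis norm_ge_zero power_eq_imp_eq_base power_one zero_le_one)
      then show "w \<noteq> 0" by auto
    qed
    have "\<exists>Q. [:- a, 1:] * Q = D - [:poly D a:] \<and> poly Q a = poly (pderiv D) a \<and> degree Q \<le> m - 1"
      for a unfolding D_def by (metis dickson_quotient)
    then obtain q where q: "\<And>a. [:- a, 1:] * q a = D - [:poly D a:]"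
      "\<And>a. poly (q a) a = poly (pderiv D) a" "\<And>a. degree (q a) \<le> m - 1" by metis
    define Q where "Q w = q (w + GG / w)" for w
    have sumQ: "(\<Sum>w\<in>W. Polynomial.smult (w - GG / w) (Q w)) = [:of_nat m * (s - GG ^ m / s):]"
      unfolding W_def
      by (rule sum_dickson_quotients[OF m s nG])
        (use q in \<open>simp_all only: Q_def D_def\<close>)
    define d where "d = s + GG ^ m / s"
    have DW: "poly D (w + GG / w) = d" if "w \<in> W" for w
      using that nW by (simp add: D_def poly_dickson power_divide W_def d_def)
    \<comment> \<open>Positivity at each root \<open>w\<close> is applied to p = Q w. The first
      argument of the form becomes d - D, the same for all roots, so the sum can be moved into the
      second argument, where it is constant.\<close>
    have "0 \<le> (\<Sum>w\<in>W. Re (cnj (w - GG / w) * B ([:w + GG / w, - 1:] * Q w) (Q w)))"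
      by (intro sum_nonneg) (use pos nW in \<open>auto simp: GG_def\<close>)
    also have "\<dots> = (\<Sum>w\<in>W. Re (cnj (w - GG / w) * B ([:d:] - D) (Q w)))"
    proof (rule sum.cong[OF refl])
      fix w assume w: "w \<in> W"
      have "[:w + GG / w, - 1:] * Q w = (- [:- (w + GG / w), 1:]) * Q w" by (simp add: add.commute)
      also have "\<dots> = - ([:- (w + GG / w), 1:] * Q w)" by (rule mult_minus_left)
      also have "\<dots> = [:d:] - D" using q(1)[of "w + GG / w"] DW[OF w] by (simp add: Q_def)
      finally show "Re (cnj (w - GG / w) * B ([:w + GG / w, - 1:] * Q w) (Q w))
         = Re (cnj (w - GG / w) * B ([:d:] - D) (Q w))" by simp
    qed
    also have "\<dots> = Re (B ([:d:] - D) (\<Sum>w\<in>W. Polynomial.smult (w - GG / w) (Q w)))"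
      by (simp add: B_sum' B_smult')
    also have "(\<Sum>w\<in>W. Polynomial.smult (w - GG / w) (Q w))
         = Polynomial.smult (of_nat m * (s - GG ^ m / s)) 1"
      using sumQ by simp
    also have "Re (B ([:d:] - D) \<dots>)
         = real m * Re (cnj (s - GG ^ m / s) * B ([:d:] - D) 1)"
      by (simp only: B_smult' complex_cnj_mult complex_cnj_of_nat mult.assoc Re_of_nat_mult)
    also have "B ([:d:] - D) 1 = d * of_real b - B D 1"
      using B_smult[of d 1 1] by (simp add: B_diff b)
    finally show ?thesis using m by (simp add: d_def zero_le_mult_iff)
  qed
  define P where "P = B D 1"
  \<comment> \<open>Adding the inequalities for w = 1 and w = -1 cancels the unknown value of the
    form at x.\<close>
  have b0: "0 \<le> b"
  proof -
    have "0 \<le> Re (cnj (1 - GG) * ((1 + GG) * of_real b - B [:0,1:] 1))"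
      using pos[of 1 1] B_smult[of "1 + GG" 1 1] B_diff[of "Polynomial.smult (1 + GG) 1" "[:0,1:]" 1]
      by (simp add: GG_def b)
    moreover have "0 \<le> Re (cnj (- 1 + GG) * ((- 1 - GG) * of_real b - B [:0,1:] 1))"
      using pos[of "-1" 1] B_smult[of "-1 - GG" 1 1] B_diff[of "Polynomial.smult (-1 - GG) 1" "[:0,1:]" 1]
      by (simp add: GG_def b)
    ultimately have "0 \<le> (1 - G) * (1 + G) * b"
      by (simp add: GG_def algebra_simps)
    moreover have "0 < (1 - G) * (1 + G)" using G by (intro mult_pos_pos) auto
    ultimately show ?thesis by (simp add: zero_le_mult_iff)
  qed
  show ?thesis
  proof (cases "P = 0")
    case True then show ?thesis using b0 by (simp add: P_def D_def GG_def)
  next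
    case False
    \<comment> \<open>In the direction of P itself, \<open>key\<close> becomes a bound on the
      modulus of P.\<close>
    define s where "s = sgn P"
    have s: "norm s = 1" using False by (simp add: s_def norm_sgn)
    have s1: "1 / s = cnj s" using s complex_div_cnj[of 1 s] by simp
    define p where "p = norm P"
    have Ps: "P = of_real p * s"
      using False by (simp add: s_def p_def sgn_div_norm scaleR_conv_of_real)
    define g where "g = G ^ m"
    have g: "GG ^ m = of_real g" by (simp add: GG_def g_def)
    have "\<bar>g\<bar> < 1" using G m by (simp add: g_def power_abs power_less_one_iff)
    have ss: "s * cnj s = 1" using s by (simp add: complex_norm_square[symmetric])
    obtain x y where xy: "s = Complex x y" by (cases s)
    have xy1: "x^2 + y^2 = 1" using s by (simp add: xy cmod_def)
    have gs: "GG ^ m / s = of_real g * cnj s" unfolding g s1[symmetric] by simp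
    have "0 \<le> Re (cnj (s - of_real g * cnj s) * ((s + of_real g * cnj s) * of_real b - P))"
      using key[OF s] by (simp only: gs P_def)
    also have "\<dots> = (1 - g\<^sup>2) * b * (x\<^sup>2 + y\<^sup>2) - p * ((x\<^sup>2 + y\<^sup>2) - g * (x\<^sup>2 - y\<^sup>2))"
      unfolding Ps by (simp add: xy algebra_simps power2_eq_square)
    finally have 1: "norm P * (1 - g * (x^2-y^2)) \<le> (1 - g^2) * b" using xy1 by (simp add: p_def)
    \<comment> \<open>As x^2 - y^2 = Re (s^2) lies in [-1, 1], the factor of |P| is at least 1 -
      |g|. It cancels against 1 - g^2 and leaves 1 + |g|, which is below 2.\<close>
    have "g * (x^2-y^2) \<le> \<bar>g\<bar> * \<bar>x^2-y^2\<bar>" by (metis abs_ge_self abs_mult)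
    also have "\<bar>x^2-y^2\<bar> \<le> 1" using xy1 zero_le_power2[of x] zero_le_power2[of y] by linarith
    then have "\<bar>g\<bar> * \<bar>x^2-y^2\<bar> \<le> \<bar>g\<bar> * 1" by (intro mult_left_mono) auto
    finally have "norm P * (1 - \<bar>g\<bar>) \<le> norm P * (1 - g * (x^2-y^2))"
      by (intro mult_left_mono) auto
    also note 1
    also have "(1 - g^2) * b = ((1 + \<bar>g\<bar>) * b) * (1 - \<bar>g\<bar>)"
      by (simp add: algebra_simps power2_eq_square flip: abs_mult)
    finally have "norm P \<le> (1 + \<bar>g\<bar>) * b" using \<open>\<bar>g\<bar> < 1\<close> by simp
    also have "\<dots> \<le> 2 * b" using \<open>\<bar>g\<bar> < 1\<close> b0 by (intro mult_right_mono) auto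
    finally show ?thesis by (simp add: P_def D_def GG_def)
  qed
qed

section \<open>Polynomials in a matrix, applied to a complex vector\<close>

definition mat_act :: "nat \<Rightarrow> (nat \<Rightarrow> nat \<Rightarrow> complex) \<Rightarrow> (nat \<Rightarrow> complex) \<Rightarrow> nat \<Rightarrow> complex" where
  "mat_act N t u i = (\<Sum>j\<in>{0..<N}. t i j * u j)"

text \<open>The vector p(t) u. Vectors are plain functions of which only the entries below
  \<open>N\<close> matter, which keeps carrier conditions out of the polynomial identities.\<close>

definition poly_act :: "nat \<Rightarrow> (nat \<Rightarrow> nat \<Rightarrow> complex) \<Rightarrow> (nat \<Rightarrow> complex) \<Rightarrow> complex poly \<Rightarrow> nat \<Rightarrow> complex" where
  "poly_act N t u p i = (\<Sum>k\<le>degree p. coeff p k * (mat_act N t ^^ k) u i)"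

lemma poly_act_eq:
  assumes "degree p \<le> n"
  shows "poly_act N t u p i = (\<Sum>k\<le>n. coeff p k * (mat_act N t ^^ k) u i)"
  unfolding poly_act_def using assms
  by (intro sum.mono_neutral_left) (auto simp: coeff_eq_0)

lemma poly_act_add: "poly_act N t u (p + q) i = poly_act N t u p i + poly_act N t u q i"
proof -
  define n where "n = max (degree p) (degree q)"
  have "degree p \<le> n" "degree q \<le> n" "degree (p + q) \<le> n"
    by (auto simp: n_def degree_add_le_max)
  then show ?thesis
    by (simp add: poly_act_eq distrib_right sum.distrib)
qed

lemma poly_act_smult: "poly_act N t u (Polynomial.smult c p) i = c * poly_act N t u p i"
  by (subst poly_act_eq[OF degree_smult_le]) (simp add: poly_act_def sum_distrib_left mult.assoc)

lemma poly_act_diff: "poly_act N t u (p - q) i = poly_act N t u p i - poly_act N t u q i"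
  using poly_act_add[of N t u p "Polynomial.smult (-1) q" i] poly_act_smult[of N t u "-1" q i]
  by simp

lemma mat_act_sum: "mat_act N t (\<lambda>i. \<Sum>k\<in>K. c k * f k i) i = (\<Sum>k\<in>K. c k * mat_act N t (f k) i)"
  unfolding mat_act_def
  by (simp add: sum_distrib_left mult.left_commute sum.swap[of _ K])

text \<open>Horner's rule: multiplying a polynomial by x means applying the matrix once
  more.\<close>

lemma poly_act_pCons:
  "poly_act N t u (pCons a p) i = a * u i + mat_act N t (poly_act N t u p) i"
proof -
  have "poly_act N t u (pCons a p) i = (\<Sum>k\<le>Suc (degree p). coeff (pCons a p) k * (mat_act N t ^^ k) u i)"
    by (rule poly_act_eq[OF degree_pCons_le])
  also have "\<dots> = a * u i + (\<Sum>k\<le>degree p. coeff p k * mat_act N t ((mat_act N t ^^ k) u) i)"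
    by (subst sum.atMost_Suc_shift) simp
  also have "\<dots> = a * u i + mat_act N t (\<lambda>i. poly_act N t u p i) i"
    unfolding poly_act_def by (simp add: mat_act_sum)
  finally show ?thesis .
qed

text \<open>The form is B(p, q) = <p(t)u, q(t)u>. Since w - G/w is the outer normal at the point w +
  G/w of the ellipse traced by |w| = 1, the hypothesis puts the numerical range of \<open>t\<close>
  into every supporting half-plane of that ellipse. It is applied to the vectors p(t)u.\<close>

lemma dickson_numerical_radius:
  fixes G :: real
  assumes G: "\<bar>G\<bar> < 1" and m: "0 < m"
    and pos: "\<And>w u. norm w = 1 \<Longrightarrow> 0 \<le> Re (cnj (w - of_real G / w) *
       (\<Sum>i\<in>{0..<N}. ((w + of_real G / w) * u i - mat_act N t u i) * cnj (u i)))"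
  shows "norm (\<Sum>i\<in>{0..<N}. poly_act N t u (dickson (of_real G) m) i * cnj (u i))
    \<le> 2 * (\<Sum>i\<in>{0..<N}. (norm (u i))\<^sup>2)"
proof -
  define B where "B p q = (\<Sum>i\<in>{0..<N}. poly_act N t u p i * cnj (poly_act N t u q i))" for p q
  have one: "poly_act N t u 1 i = u i" for i by (simp add: poly_act_def)
  have "norm (B (dickson (of_real G) m) 1) \<le> 2 * (\<Sum>i\<in>{0..<N}. (norm (u i))\<^sup>2)"
  proof (rule dickson_form_bound[OF _ _ _ _ G _ _ m])
    show "B 1 1 = of_real (\<Sum>i\<in>{0..<N}. (norm (u i))\<^sup>2)"
      unfolding B_def one by (simp add: complex_norm_square flip: of_real_power)
  next
    fix w p assume w: "norm (w::complex) = 1"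
    have "[:w + of_real G / w, - 1:] * p = Polynomial.smult (w + of_real G / w) p - pCons 0 p"
      by simp
    then show "0 \<le> Re (cnj (w - of_real G / w) * B ([:w + of_real G / w, - 1:] * p) p)"
      using pos[OF w, of "poly_act N t u p"]
      by (simp only: B_def poly_act_diff poly_act_smult poly_act_pCons) simp
  qed (simp_all add: B_def poly_act_add poly_act_smult algebra_simps sum.distrib sum_distrib_left)
  then show ?thesis unfolding B_def one .
qed

section \<open>Dickson polynomials of a real matrix and their norms\<close>

fun dickson_vec :: "real mat \<Rightarrow> real \<Rightarrow> real vec \<Rightarrow> nat \<Rightarrow> real vec" where
  "dickson_vec T G b 0 = 2 \<cdot>\<^sub>v b"
| "dickson_vec T G b (Suc 0) = T *\<^sub>v b"
| "dickson_vec T G b (Suc (Suc n)) = T *\<^sub>v dickson_vec T G b (Suc n) - G \<cdot>\<^sub>v dickson_vec T G b n"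

lemma dickson_vec_carrier [simp]:
  assumes "T \<in> carrier_mat N N" "b \<in> carrier_vec N"
  shows "dickson_vec T G b n \<in> carrier_vec N"
  by (induction n rule: induct_nat_012) (use assms in \<open>auto intro: mult_mat_vec_carrier\<close>)

lemma dickson_vec_add:
  assumes T: "T \<in> carrier_mat N N" and x: "x \<in> carrier_vec N" and y: "y \<in> carrier_vec N"
  shows "dickson_vec T G (x + y) n = dickson_vec T G x n + dickson_vec T G y n"
proof (induction n rule: induct_nat_012)
  case 0 show ?case using x y by (simp add: smult_add_distrib_vec)
next
  case 1 show ?case using T x y by (simp add: mult_add_distrib_mat_vec)
next
  case (ge2 n)
  note c = dickson_vec_carrier[OF T x, of G] dickson_vec_carrier[OF T y, of G]
  show ?case
  proof (rule eq_vecI)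
    show "dim_vec (dickson_vec T G (x + y) (Suc (Suc n))) =
      dim_vec (dickson_vec T G x (Suc (Suc n)) + dickson_vec T G y (Suc (Suc n)))"
      using dickson_vec_carrier[OF T y] dickson_vec_carrier[OF T add_carrier_vec[OF x y]]
      by (metis carrier_vecD index_add_vec(2))
    fix i assume "i < dim_vec (dickson_vec T G x (Suc (Suc n)) + dickson_vec T G y (Suc (Suc n)))"
    then have "i < N" using c(2)[of "Suc (Suc n)"] by (metis carrier_vecD index_add_vec(2))
    then show "dickson_vec T G (x + y) (Suc (Suc n)) $ i =
      (dickson_vec T G x (Suc (Suc n)) + dickson_vec T G y (Suc (Suc n))) $ i"
      using ge2 c[of n] c[of "Suc n"] T
      by (simp add: mult_add_distrib_mat_vec[OF T] algebra_simps scalar_prod_add_distrib[of _ N]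
          carrier_vecD[OF c(1)[of n]] carrier_vecD[OF c(2)[of n]])
  qed
qed

lemma mult_mat_vec_index_sum:
  assumes "T \<in> carrier_mat N N" "v \<in> carrier_vec N" "i < N"
  shows "(T *\<^sub>v v) $ i = (\<Sum>j\<in>{0..<N}. T $$ (i, j) * v $ j)"
  using assms by (simp add: scalar_prod_def)

lemma Complex_mult_real: "complex_of_real a * Complex b c = Complex (a * b) (a * c)"
  by (simp add: complex_eq_iff)

lemma Complex_sum: "(\<Sum>i\<in>A. Complex (f i) (g i)) = Complex (sum f A) (sum g A)"
  by (induction A rule: infinite_finite_induct) (auto simp: complex_eq_iff)

text \<open>A real matrix acts separately on real and imaginary parts. This links the complex
  polynomial calculus to the real recurrence vectors.\<close>

lemma poly_act_dickson:
  assumes T: "T \<in> carrier_mat N N" and x: "x \<in> carrier_vec N" and y: "y \<in> carrier_vec N" and "i < N"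
  shows "poly_act N (\<lambda>i j. of_real (T $$ (i, j))) (\<lambda>i. Complex (x $ i) (y $ i)) (dickson (of_real G) n) i
     = Complex (dickson_vec T G x n $ i) (dickson_vec T G y n $ i)"
  using \<open>i < N\<close>
proof (induction n arbitrary: i rule: induct_nat_012)
  case 0
  then show ?case using x y by (simp add: poly_act_def complex_eq_iff)
next
  case 1
  then show ?case using T x y
    by (simp add: poly_act_pCons poly_act_def[where p = 0] mat_act_def mult_mat_vec_index_sum[OF T]
        Complex_mult_real Complex_sum poly_act_def[where p = 1] del: index_mult_mat_vec flip: one_pCons)
next
  case (ge2 n)
  note c = dickson_vec_carrier[OF T x, of G] dickson_vec_carrier[OF T y, of G]
  show ?case
    using ge2 T c[of n] c[of "Suc n"]
    by (simp add: poly_act_pCons poly_act_diff poly_act_smult mat_act_def mult_mat_vec_index_sum[OF T]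
        Complex_mult_real Complex_sum carrier_vecD[OF c(1)[of n]] carrier_vecD[OF c(2)[of n]] del: index_mult_mat_vec)
      (simp add: complex_eq_iff)
qed

text \<open>A numerical radius of at most 2 is turned into a norm bound. The value of the form at v
  + iw has the skew part of <Mv, w> as its imaginary part (bound 2), and polarization handles the
  symmetric part (bound 6). Together they give |<Mv, w>| \<le> 4(|v|^2 + |w|^2).\<close>

lemma dickson_vec_norm:
  fixes G :: real
  assumes T: "T \<in> carrier_mat N N" and G: "\<bar>G\<bar> < 1" and m: "0 < m"
    and pos: "\<And>w u. norm w = 1 \<Longrightarrow> 0 \<le> Re (cnj (w - of_real G / w) *
       (\<Sum>i\<in>{0..<N}. ((w + of_real G / w) * u i
           - mat_act N (\<lambda>i j. of_real (T $$ (i, j))) u i) * cnj (u i)))"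
    and x: "x \<in> carrier_vec N"
  shows "euclid_norm (dickson_vec T G x m) \<le> 8 * euclid_norm x"
proof -
  define M where "M v = dickson_vec T G v m" for v
  have M: "M v \<in> carrier_vec N" if "v \<in> carrier_vec N" for v
    unfolding M_def using dickson_vec_carrier[OF T that] .
  have Madd: "M (v + w) = M v + M w" if "v \<in> carrier_vec N" "w \<in> carrier_vec N" for v w
    unfolding M_def using dickson_vec_add[OF T that] .
  have bound: "norm (Complex (M v \<bullet> v + M w \<bullet> w) (M w \<bullet> v - M v \<bullet> w)) \<le> 2 * (v \<bullet> v + w \<bullet> w)"
    if v: "v \<in> carrier_vec N" and w: "w \<in> carrier_vec N" for v w
  proof -
    have "(\<Sum>i\<in>{0..<N}. poly_act N (\<lambda>i j. of_real (T $$ (i, j))) (\<lambda>i. Complex (v $ i) (w $ i)) (dickson (of_real G) m) i * cnj (Complex (v $ i) (w $ i)))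
      = (\<Sum>i\<in>{0..<N}. Complex (M v $ i * v $ i + M w $ i * w $ i) (M w $ i * v $ i - M v $ i * w $ i))"
      by (intro sum.cong refl) (simp add: poly_act_dickson[OF T v w] M_def complex_eq_iff)
    also have "\<dots> = Complex (M v \<bullet> v + M w \<bullet> w) (M w \<bullet> v - M v \<bullet> w)"
      using v w by (simp add: Complex_sum scalar_prod_def sum.distrib sum_subtractf)
    finally have 1: "(\<Sum>i\<in>{0..<N}. poly_act N (\<lambda>i j. of_real (T $$ (i, j))) (\<lambda>i. Complex (v $ i) (w $ i)) (dickson (of_real G) m) i * cnj (Complex (v $ i) (w $ i)))
      = Complex (M v \<bullet> v + M w \<bullet> w) (M w \<bullet> v - M v \<bullet> w)" .
    have 2: "(\<Sum>i\<in>{0..<N}. (norm (Complex (v $ i) (w $ i)))\<^sup>2) = v \<bullet> v + w \<bullet> w"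
      using v w by (simp add: cmod_power2 scalar_prod_def sum.distrib flip: power2_eq_square)
    show ?thesis
      using dickson_numerical_radius[OF G m pos, where u = "\<lambda>i. Complex (v $ i) (w $ i)"] unfolding 1 2 by simp
  qed
  have z: "0\<^sub>v N \<in> carrier_vec N" by simp
  have q0: "0 \<le> v \<bullet> v" for v :: "real vec" by (simp add: scalar_prod_def sum_nonneg)
  have quad: "\<bar>M v \<bullet> v\<bar> \<le> 2 * (v \<bullet> v)" if v: "v \<in> carrier_vec N" for v
    using order_trans[OF abs_Re_le_cmod bound[OF v z]] v M[OF v] M[OF z] by simp
  have bil: "\<bar>M v \<bullet> w\<bar> \<le> 4 * (v \<bullet> v + w \<bullet> w)" if v: "v \<in> carrier_vec N" and w: "w \<in> carrier_vec N" for v w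
  proof -
    have sym: "v \<bullet> w = w \<bullet> v" using comm_scalar_prod[OF v w] .
    have sq: "2 * (w \<bullet> v) \<le> v \<bullet> v + w \<bullet> w"
    proof -
      have "0 \<le> (v - w) \<bullet> (v - w)" by (rule q0)
      also have "\<dots> = v \<bullet> v + w \<bullet> w - 2 * (w \<bullet> v)"
        using v w sym by (simp add: minus_scalar_prod_distrib[of _ N] scalar_prod_minus_distrib[of _ N])
      finally show ?thesis by simp
    qed
    have 1: "\<bar>M w \<bullet> v - M v \<bullet> w\<bar> \<le> 2 * (v \<bullet> v + w \<bullet> w)"
      using order_trans[OF abs_Im_le_cmod bound[OF v w]] by simp
    have "M (v + w) \<bullet> (v + w) = M v \<bullet> v + M w \<bullet> w + (M v \<bullet> w + M w \<bullet> v)"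
      using v w M[OF v] M[OF w]
      by (simp add: Madd add_scalar_prod_distrib[of _ N] scalar_prod_add_distrib[of _ N])
    moreover have "(v + w) \<bullet> (v + w) = v \<bullet> v + w \<bullet> w + 2 * (w \<bullet> v)"
      using v w sym by (simp add: add_scalar_prod_distrib[of _ N] scalar_prod_add_distrib[of _ N])
    ultimately have "\<bar>M v \<bullet> w + M w \<bullet> v\<bar> \<le> 6 * (v \<bullet> v + w \<bullet> w)"
      using quad[OF v] quad[OF w] quad[of "v + w"] v w sq by (simp add: abs_le_iff)
    with 1 show ?thesis by (simp add: abs_le_iff)
  qed
  \<comment> \<open>With y = a M x, the bound \<open>bil\<close> reads (a - 4a^2) |Mx|^2 \<le> 4
    |x|^2, and a = 1/8 maximizes a - 4a^2.\<close>
  define y where "y = (1 / 8) \<cdot>\<^sub>v M x"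
  have y: "y \<in> carrier_vec N" using M[OF x] by (simp add: y_def)
  have "M x \<bullet> y = M x \<bullet> M x / 8" "y \<bullet> y = M x \<bullet> M x / 64"
    using M[OF x] by (simp_all add: y_def)
  then have "M x \<bullet> M x \<le> 64 * (x \<bullet> x)" using bil[OF x y] by (simp add: abs_le_iff)
  then have "sqrt (M x \<bullet> M x) \<le> sqrt (8\<^sup>2 * (x \<bullet> x))" by simp
  then show ?thesis by (simp add: euclid_norm_def M_def real_sqrt_mult)
qed

subsection \<open>The exterior map of an ellipse\<close>

text \<open>The roots of v^2 - \<zeta> v + g^2 have product g^2, so the larger one has modulus at
  least |g|.\<close>

lemma joukowski_surj:
  fixes g \<zeta> :: complex
  obtains v where "norm g \<le> norm v" "\<zeta> = v + g\<^sup>2 / v"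
proof -
  define s where "s = csqrt (\<zeta>\<^sup>2 - 4 * g\<^sup>2)"
  have s: "s\<^sup>2 = \<zeta>\<^sup>2 - 4 * g\<^sup>2" by (simp add: s_def)
  define v1 v2 where "v1 = (\<zeta> + s) / 2" and "v2 = (\<zeta> - s) / 2"
  have p: "v1 * v2 = g\<^sup>2" "v1 + v2 = \<zeta>"
    using s by (auto simp: v1_def v2_def field_simps power2_eq_square)
  have *: "\<exists>v. norm g \<le> norm v \<and> \<zeta> = v + g\<^sup>2 / v"
    if "x * y = g\<^sup>2" "x + y = \<zeta>" "norm y \<le> norm x" for x y
  proof (intro exI conjI)
    have "norm x * norm y = (norm g)\<^sup>2" using that(1) by (simp flip: norm_mult norm_power)
    moreover have "norm x * norm y \<le> (norm x)\<^sup>2"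
      using that(3) by (simp add: power2_eq_square mult_left_mono)
    ultimately show "norm g \<le> norm x" by (simp add: power2_le_iff_abs_le)
    show "\<zeta> = x + g\<^sup>2 / x"
    proof (cases "x = 0")
      \<comment> \<open>Here y and \<zeta> vanish as well, and the equation holds because division
        by 0 yields 0.\<close>
      case True then show ?thesis using that by auto
    next
      case False
      then have "y = g\<^sup>2 / x" using that(1) by (simp add: field_simps)
      then show ?thesis using that(2) by simp
    qed
  qed
  show ?thesis
  proof (cases "norm v2 \<le> norm v1")
    case True then show ?thesis using *[of v1 v2] p that by blast
  next
    case False
    then have "\<exists>v. norm g \<le> norm v \<and> \<zeta> = v + g\<^sup>2 / v"
      by (intro *[of v2 v1]) (use p in \<open>simp_all add: ac_simps\<close>)
    then show ?thesis using that by blast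
  qed
qed

text \<open>The differences from z to the foci are \<gamma> (w - g)^2 / w and \<gamma> (w + g)^2 /
  w, so the parallelogram law sums the distances. The result depends on |w| only: circles go to
  confocal ellipses.\<close>

lemma joukowski_focal_sum:
  fixes g c w :: complex and \<gamma> :: real
  assumes "w \<noteq> 0" "0 < \<gamma>"
  defines "z \<equiv> of_real \<gamma> * (w + g\<^sup>2 / w) + c"
  shows "dist z (c + 2 * of_real \<gamma> * g) + dist z (c - 2 * of_real \<gamma> * g)
    = 2 * \<gamma> * (norm w + (norm g)\<^sup>2 / norm w)"
proof -
  have 1: "z - (c + 2 * of_real \<gamma> * g) = of_real \<gamma> * (w - g)\<^sup>2 / w"
    and 2: "z - (c - 2 * of_real \<gamma> * g) = of_real \<gamma> * (w + g)\<^sup>2 / w"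
    using assms(1) by (simp_all add: z_def field_simps power2_eq_square)
  have "(norm (w - g))\<^sup>2 + (norm (w + g))\<^sup>2 = 2 * ((norm w)\<^sup>2 + (norm g)\<^sup>2)"
    unfolding cmod_power2 by (simp add: power2_eq_square algebra_simps)
  then have "\<gamma> * (norm (w - g))\<^sup>2 / norm w + \<gamma> * (norm (w + g))\<^sup>2 / norm w
     = \<gamma> * (2 * ((norm w)\<^sup>2 + (norm g)\<^sup>2)) / norm w"
    by (simp only: flip: add_divide_distrib distrib_left)
  also have "\<dots> = 2 * \<gamma> * (norm w + (norm g)\<^sup>2 / norm w)"
    using assms(1) by (simp add: field_simps power2_eq_square)
  finally show ?thesis
    unfolding dist_norm 1 2 using assms(2) by (simp add: norm_mult norm_divide norm_power)
qed

text \<open>For |g| < 1 and positive \<gamma>, the ellipse bounded by the image of the unit circle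
  under w -> \<gamma> (w + g^2/w) + c. The complex \<open>g\<close> encodes eccentricity and
  rotation: the foci are c + 2 \<gamma> g and c - 2 \<gamma> g.\<close>

definition joukowski_ellipse :: "real \<Rightarrow> complex \<Rightarrow> complex \<Rightarrow> complex set" where
  "joukowski_ellipse \<gamma> g c =
     {z. dist z (c + 2 * of_real \<gamma> * g) + dist z (c - 2 * of_real \<gamma> * g) \<le> 2 * \<gamma> * (1 + (norm g)\<^sup>2)}"

text \<open>With t = |w| and h = |g|^2 the focal condition is t + h/t \<le> 1 + h, that is, (t -
  1)(t - h) \<le> 0. Requiring |g| \<le> |w| selects the outer one of the two preimages.\<close>

lemma joukowski_in_ellipse_iff:
  assumes "0 < \<gamma>" "norm g < 1" "norm g \<le> norm w"
  shows "of_real \<gamma> * (w + g\<^sup>2 / w) + c \<in> joukowski_ellipse \<gamma> g c \<longleftrightarrow> norm w \<le> 1"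
proof (cases "w = 0")
  case True
  then show ?thesis using assms by (simp add: joukowski_ellipse_def)
next
  case False
  define t where "t = norm w"
  define h where "h = (norm g)\<^sup>2"
  have t: "0 < t" using False by (simp add: t_def)
  have h: "0 \<le> h" "h < 1" using assms by (auto simp: h_def power_less_one_iff abs_square_less_1)
  have "h \<le> t\<^sup>2" using assms by (simp add: h_def t_def power_mono)
  have "t + h / t \<le> 1 + h \<longleftrightarrow> t \<le> 1"
  proof
    assume "t \<le> 1"
    have "h \<le> t" using \<open>h \<le> t\<^sup>2\<close> mult_left_le[OF \<open>t \<le> 1\<close>, of t] t(1)
      unfolding power2_eq_square by linarith
    then have "0 \<le> (1 - t) * (t - h)" using \<open>t \<le> 1\<close> by simp
    then show "t + h / t \<le> 1 + h" using t by (simp add: field_simps)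
  next
    assume "t + h / t \<le> 1 + h"
    then have "(t - 1) * (t - h) \<le> 0" using t by (simp add: field_simps)
    then show "t \<le> 1" using h by (auto simp: mult_le_0_iff)
  qed
  moreover have "2 * \<gamma> * (t + h / t) \<le> 2 * \<gamma> * (1 + h) \<longleftrightarrow> t + h / t \<le> 1 + h"
    using assms(1) by (subst mult_le_cancel_left_pos) auto
  ultimately show ?thesis
    using False assms(1) unfolding joukowski_ellipse_def mem_Collect_eq
    by (subst joukowski_focal_sum) (simp_all add: t_def h_def)
qed

lemma filled_ellipse_joukowski:
  assumes "filled_ellipse \<Omega>"
  obtains \<gamma> g c where "0 < \<gamma>" "norm g < 1" "\<Omega> = joukowski_ellipse \<gamma> g c"
proof -
  from assms obtain p q a where a: "dist p q < 2 * a"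
    and Om: "\<Omega> = {z. dist z p + dist z q \<le> 2 * a}" unfolding filled_ellipse_def by auto
  define e where "e = (p - q) / 2"
  define c where "c = (p + q) / 2"
  have e: "norm e < a" using a by (simp add: e_def dist_norm norm_divide)
  then have e2: "(norm e)\<^sup>2 \<le> a\<^sup>2" by (simp add: power_mono)
  \<comment> \<open>Half the sum of the semi-axes \<open>a\<close> and sqrt(a^2 - |e|^2), with
    \<open>e\<close> the vector from the centre to a focus.\<close>
  define \<gamma> where "\<gamma> = (a + sqrt (a\<^sup>2 - (norm e)\<^sup>2)) / 2"
  have "0 < a" using e norm_ge_zero[of e] by linarith
  have g: "a \<le> 2 * \<gamma>" using e2 by (simp add: \<gamma>_def)
  have g0: "0 < \<gamma>" using g \<open>0 < a\<close> by simp
  define g where "g = e / of_real (2 * \<gamma>)"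
  have ng: "norm g = norm e / (2 * \<gamma>)" using g0 by (simp add: g_def norm_divide)
  have "norm g < 1" using ng e \<open>a \<le> 2 * \<gamma>\<close> g0 by simp
  have "2 * \<gamma> - a = sqrt (a\<^sup>2 - (norm e)\<^sup>2)" by (simp add: \<gamma>_def field_simps)
  then have "(2 * \<gamma> - a)\<^sup>2 = a\<^sup>2 - (norm e)\<^sup>2" using e2 by simp
  then have "\<gamma> * (1 + (norm g)\<^sup>2) = a"
    using g0 by (simp add: ng field_simps power2_eq_square)
  then have "2 * \<gamma> * (1 + (norm g)\<^sup>2) = 2 * a" by (simp only: mult.assoc)
  moreover have "c + 2 * of_real \<gamma> * g = p" "c - 2 * of_real \<gamma> * g = q"
    using g0 by (auto simp: g_def c_def e_def field_simps)
  ultimately have "\<Omega> = joukowski_ellipse \<gamma> g c"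
    unfolding Om joukowski_ellipse_def by (simp only:)
  with that g0 \<open>norm g < 1\<close> show ?thesis by blast
qed

lemma convex_joukowski_ellipse: "convex (joukowski_ellipse \<gamma> g c)"
proof -
  define f where "f z = dist (c + 2 * of_real \<gamma> * g) z + dist (c - 2 * of_real \<gamma> * g) z" for z
  have f: "convex_on UNIV f"
    unfolding f_def by (intro convex_on_add convex_on_dist convex_UNIV)
  have "convex {z. f z \<le> r}" for r
    unfolding convex_alt using convex_onD[OF f] convex_bound_le
    by (auto intro!: order_trans[OF convex_onD[OF f]] convex_bound_le)
  then show ?thesis
    unfolding joukowski_ellipse_def f_def by (simp add: dist_commute)
qed

lemma closed_joukowski_ellipse: "closed (joukowski_ellipse \<gamma> g c)"
  unfolding joukowski_ellipse_def by (intro closed_Collect_le continuous_intros)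

text \<open>Geometrically, \<zeta> lies on the inner side of the tangent to the ellipse at w + G/w,
  whose outer normal is w - G/w. Writing t = |v|, both inner products of \<open>w\<close> with
  \<open>v\<close> and its conjugate are at most t in modulus, which reduces the claim to t + |G|/t
  \<le> 1 + |G|.\<close>

lemma joukowski_support:
  fixes G :: real and w \<zeta> :: complex
  assumes G: "\<bar>G\<bar> < 1" and w: "norm w = 1" and v: "\<bar>G\<bar> \<le> (norm v)\<^sup>2" "norm v \<le> 1"
    and \<zeta>: "\<zeta> = v + of_real G / v"
  shows "0 \<le> Re (cnj (w - of_real G / w) * (w + of_real G / w - \<zeta>))"
proof (cases "v = 0")
  case True
  then show ?thesis using assms complex_norm_square[of w] by (simp flip: complex_norm_square)
next
  case False
  obtain a b where wab: "w = Complex a b" by (cases w)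
  obtain x y where vxy: "v = Complex x y" by (cases v)
  define t where "t = norm v"
  have t: "0 < t" "t \<le> 1" "\<bar>G\<bar> \<le> t\<^sup>2" using False v by (auto simp: t_def)
  have t2: "x\<^sup>2 + y\<^sup>2 = t\<^sup>2" by (simp add: t_def vxy cmod_def)
  have w2: "a\<^sup>2 + b\<^sup>2 = 1" using w by (simp add: wab cmod_def)
  have iw: "of_real G / w = of_real G * cnj w"
    using w complex_div_cnj[of "of_real G" w] by simp
  have iv: "of_real G / v = of_real (G / t\<^sup>2) * cnj v"
    using complex_div_cnj[of "of_real G" v] by (simp add: t_def)
  have eq: "Re (cnj (w - of_real G / w) * (w + of_real G / w - \<zeta>))
    = (1 - G\<^sup>2) * (a\<^sup>2 + b\<^sup>2) - ((1 - G\<^sup>2 / t\<^sup>2) * (a * x + b * y) + G * (1 / t\<^sup>2 - 1) * (a * x - b * y))"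
    unfolding \<zeta> iw iv by (simp add: wab vxy algebra_simps power2_eq_square add_divide_distrib diff_divide_distrib)
  have cs1: "a * x + b * y \<le> t"
  proof -
    have "(a * x + b * y)\<^sup>2 \<le> (a * x + b * y)\<^sup>2 + (a * y - b * x)\<^sup>2" by simp
    also have "\<dots> = (a\<^sup>2 + b\<^sup>2) * (x\<^sup>2 + y\<^sup>2)" by (simp add: power2_eq_square algebra_simps)
    also have "\<dots> = t\<^sup>2" by (simp add: t2 w2)
    finally have "(a * x + b * y)\<^sup>2 \<le> t\<^sup>2" .
    then show ?thesis by (rule power2_le_imp_le) (use t in simp)
  qed
  have cs2: "\<bar>a * x - b * y\<bar> \<le> t"
  proof -
    have "(a * x - b * y)\<^sup>2 \<le> (a * x - b * y)\<^sup>2 + (a * y + b * x)\<^sup>2" by simp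
    also have "\<dots> = (a\<^sup>2 + b\<^sup>2) * (x\<^sup>2 + y\<^sup>2)" by (simp add: power2_eq_square algebra_simps)
    also have "\<dots> = t\<^sup>2" by (simp add: t2 w2)
    finally have "(a * x - b * y)\<^sup>2 \<le> t\<^sup>2" .
    then show ?thesis using abs_le_square_iff[of "a * x - b * y" t] t(1) by linarith
  qed
  have G2: "G\<^sup>2 \<le> t\<^sup>2"
  proof -
    have "G\<^sup>2 = \<bar>G\<bar> * \<bar>G\<bar>" by (simp add: power2_eq_square flip: abs_mult)
    also have "\<dots> \<le> \<bar>G\<bar> * 1" using G by (intro mult_left_mono) auto
    finally show ?thesis using t by simp
  qed
  have tsq: "t\<^sup>2 \<le> 1" using t by (simp add: power_le_one)
  have "(1 - G\<^sup>2 / t\<^sup>2) * (a * x + b * y) \<le> (1 - G\<^sup>2 / t\<^sup>2) * t"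
    using G2 t cs1 by (intro mult_left_mono) (auto simp: field_simps)
  moreover have "G * (1 / t\<^sup>2 - 1) * (a * x - b * y) \<le> \<bar>G\<bar> * (1 / t\<^sup>2 - 1) * t"
  proof -
    have p: "0 \<le> 1 / t\<^sup>2 - 1" using t tsq by (simp add: field_simps)
    have "G * (1 / t\<^sup>2 - 1) * (a * x - b * y) \<le> \<bar>G * (1 / t\<^sup>2 - 1) * (a * x - b * y)\<bar>" by simp
    also have "\<dots> = \<bar>G\<bar> * (1 / t\<^sup>2 - 1) * \<bar>a * x - b * y\<bar>" using p by (simp add: abs_mult)
    also have "\<dots> \<le> \<bar>G\<bar> * (1 / t\<^sup>2 - 1) * t" using p cs2 by (intro mult_left_mono) auto
    finally show ?thesis .
  qed
  \<comment> \<open>The left-hand side factors as (1 - |G|)(t + |G|/t), and t lies between |G| and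
    1.\<close>
  moreover have "(1 - G\<^sup>2 / t\<^sup>2) * t + \<bar>G\<bar> * (1 / t\<^sup>2 - 1) * t \<le> 1 - G\<^sup>2"
  proof -
    have Gsq: "G\<^sup>2 = \<bar>G\<bar> * \<bar>G\<bar>" by (simp add: power2_eq_square flip: abs_mult)
    have "\<bar>G\<bar> \<le> t" using t(1,3) mult_left_le[OF t(2), of t]
      unfolding power2_eq_square by linarith
    then have "0 \<le> (1 - t) * (t - \<bar>G\<bar>)" using t by simp
    then have "t + \<bar>G\<bar> / t \<le> 1 + \<bar>G\<bar>" using t by (simp add: field_simps)
    then have "(1 - \<bar>G\<bar>) * (t + \<bar>G\<bar> / t) \<le> (1 - \<bar>G\<bar>) * (1 + \<bar>G\<bar>)"
      using G by (intro mult_left_mono) auto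
    moreover have "(1 - G\<^sup>2 / t\<^sup>2) * t + \<bar>G\<bar> * (1 / t\<^sup>2 - 1) * t = (1 - \<bar>G\<bar>) * (t + \<bar>G\<bar> / t)"
      using t unfolding Gsq by (simp add: field_simps power2_eq_square)
    ultimately show ?thesis by (simp add: Gsq algebra_simps)
  qed
  ultimately show ?thesis unfolding eq w2 by simp
qed


section \<open>Uniqueness of the exterior conformal map\<close>

lemma joukowski_tendsto:
  "((\<lambda>w. (of_real \<gamma> * (w + g\<^sup>2 / w) + c) / w) \<longlongrightarrow> complex_of_real \<gamma>) at_infinity"
proof -
  have "((\<lambda>w. of_real \<gamma> * (1 + g\<^sup>2 * (inverse w * inverse w)) + c * inverse w)
    \<longlongrightarrow> of_real \<gamma> * (1 + g\<^sup>2 * (0 * 0)) + c * 0) at_infinity"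
    by (intro tendsto_intros tendsto_inverse_0)
  moreover have "\<forall>\<^sub>F w in at_infinity. of_real \<gamma> * (1 + g\<^sup>2 * (inverse w * inverse w)) + c * inverse w
      = (of_real \<gamma> * (w + g\<^sup>2 / w) + c) / w"
    using eventually_not_equal_at_infinity[of 0]
    by eventually_elim (simp add: field_simps)
  ultimately show ?thesis by (auto elim: Lim_transform_eventually)
qed

lemma joukowski_exterior_image:
  assumes "0 < \<gamma>" "norm g < 1"
  shows "(\<lambda>w. of_real \<gamma> * (w + g\<^sup>2 / w) + c) ` {w. 1 < norm w} = - joukowski_ellipse \<gamma> g c"
proof (intro equalityI subsetI)
  fix z assume "z \<in> (\<lambda>w. of_real \<gamma> * (w + g\<^sup>2 / w) + c) ` {w. 1 < norm w}"
  then show "z \<in> - joukowski_ellipse \<gamma> g c"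
    using joukowski_in_ellipse_iff[OF assms] assms by force
next
  fix z assume z: "z \<in> - joukowski_ellipse \<gamma> g c"
  obtain v where v: "norm g \<le> norm v" "(z - c) / of_real \<gamma> = v + g\<^sup>2 / v" by (rule joukowski_surj)
  then have zv: "z = of_real \<gamma> * (v + g\<^sup>2 / v) + c" using assms by (simp add: field_simps)
  then have "1 < norm v" using joukowski_in_ellipse_iff[OF assms v(1), of c] z by auto
  then show "z \<in> (\<lambda>w. of_real \<gamma> * (w + g\<^sup>2 / w) + c) ` {w. 1 < norm w}" using zv by blast
qed

text \<open>The Schwarz lemma for \<open>k\<close> and for its inverse gives |k(1/2)| = 1/2, and the
  equality case says that \<open>k\<close> is a rotation.\<close>

lemma inj_disc_automorphism:
  assumes hol: "k holomorphic_on ball 0 1" and inj: "inj_on k (ball 0 1)"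
    and im: "k ` ball 0 1 = ball 0 1" and k0: "k 0 = 0"
  obtains \<alpha> where "norm \<alpha> = 1" "\<And>z. norm z < 1 \<Longrightarrow> k z = \<alpha> * z"
proof -
  obtain l where l: "l holomorphic_on k ` ball 0 1" "\<And>z. z \<in> ball 0 1 \<Longrightarrow> l (k z) = z"
    using holomorphic_has_inverse[OF hol open_ball inj] by metis
  have l0: "l 0 = 0" using l(2)[of 0] k0 by simp
  have kb: "norm (k x) < 1" if "norm x < 1" for x using im that by (metis imageI mem_ball_0)
  have lb: "norm (l x) < 1" if "norm x < 1" for x
  proof -
    obtain y where "y \<in> ball 0 1" "x = k y" using im \<open>norm x < 1\<close> by (metis imageE mem_ball_0)
    then show ?thesis using l(2)[of y] by simp
  qed
  have h: "norm (1 / 2 :: complex) < 1" by simp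
  have 1: "norm (k (1 / 2)) \<le> norm (1 / 2 :: complex)" by (rule Schwarz_Lemma(1)[OF hol k0 kb h])
  have 2: "norm (l (k (1 / 2))) \<le> norm (k (1 / 2))"
    by (rule Schwarz_Lemma(1)[where f = l, OF _ l0 lb]) (use l(1) im kb h in auto)
  have "norm (k (1 / 2)) = norm (1 / 2 :: complex)" using 1 2 l(2)[of "1/2"] by simp
  then have "\<exists>z. norm z < 1 \<and> z \<noteq> 0 \<and> norm (k z) = norm z" using h by (intro exI[of _ "1 / 2"]) auto
  then show ?thesis using Schwarz_Lemma(3)[OF hol k0 kb h] that by blast
qed

text \<open>Let J be the Joukowski map. Then h = J^{-1} o \<psi> is a conformal bijection of the
  exterior of the disc that tends to infinity at infinity. Conjugated by inversion it is a disc
  automorphism fixing 0, hence a rotation, and the positive limit of \<psi>(w)/w makes the rotation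
  trivial.\<close>

lemma exterior_conformal_map_joukowski:
  assumes \<gamma>: "0 < \<gamma>" and g: "norm g < 1"
    and \<psi>: "exterior_conformal_map (joukowski_ellipse \<gamma> g c) \<psi>" and w: "1 < norm w"
  shows "\<psi> w = of_real \<gamma> * (w + g\<^sup>2 / w) + c"
proof -
  define E where "E = {w::complex. 1 < norm w}"
  define J where "J w = of_real \<gamma> * (w + g\<^sup>2 / w) + c" for w
  have E0: "0 \<notin> E" by (simp add: E_def)
  have "open E" unfolding E_def by (intro open_Collect_less continuous_intros)
  have J: "J holomorphic_on E" unfolding J_def using E0 by (intro holomorphic_intros) auto
  have injJ: "inj_on J E"
  proof (rule inj_onI)
    fix x y assume xy: "x \<in> E" "y \<in> E" "J x = J y"
    have "norm (g\<^sup>2) < 1" using g by (simp add: norm_power power_less_one_iff)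
    also have "1 < norm x * norm y" using xy by (simp add: E_def less_1_mult)
    finally show "x = y" using xy \<gamma> E0 by (intro joukowski_inj[of x "g\<^sup>2" y]) (auto simp: J_def)
  qed
  have imJ: "J ` E = - joukowski_ellipse \<gamma> g c"
    unfolding J_def E_def using joukowski_exterior_image[OF \<gamma> g] .
  have "\<psi> holomorphic_on E \<and> inj_on \<psi> E \<and> \<psi> ` E = - joukowski_ellipse \<gamma> g c \<and>
      (\<exists>\<delta>>0. ((\<lambda>w. \<psi> w / w) \<longlongrightarrow> complex_of_real \<delta>) at_infinity)"
    using \<psi> unfolding exterior_conformal_map_def E_def .
  then obtain \<delta> where \<psi>h: "\<psi> holomorphic_on E" and inj\<psi>: "inj_on \<psi> E" and im\<psi>: "\<psi> ` E = J ` E"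
    and \<delta>: "0 < \<delta>" "((\<lambda>w. \<psi> w / w) \<longlongrightarrow> complex_of_real \<delta>) at_infinity"
    unfolding imJ by blast
  obtain j where j: "j holomorphic_on J ` E" "\<And>z. z \<in> E \<Longrightarrow> j (J z) = z"
    using holomorphic_has_inverse[OF J \<open>open E\<close> injJ] by metis
  define h where "h = j \<circ> \<psi>"
  have hE: "h w \<in> E" "J (h w) = \<psi> w" if "w \<in> E" for w
  proof -
    have "\<psi> w \<in> J ` E" unfolding im\<psi>[symmetric] using that by (rule imageI)
    then obtain v where "v \<in> E" "\<psi> w = J v" by (rule imageE)
    then show "h w \<in> E" "J (h w) = \<psi> w" using j(2) by (auto simp: h_def)
  qed
  have injh: "inj_on h E"
  proof (rule inj_onI)
    fix x y assume xy: "x \<in> E" "y \<in> E" "h x = h y"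
    then have "\<psi> x = \<psi> y" using hE(2)[of x] hE(2)[of y] by simp
    then show "x = y" using inj\<psi> xy by (auto dest: inj_onD)
  qed
  have imh: "h ` E = E"
  proof (intro equalityI subsetI)
    fix v assume "v \<in> E"
    then have "J v \<in> \<psi> ` E" unfolding im\<psi> by (rule imageI)
    then obtain w where "J v = \<psi> w" "w \<in> E" by (rule imageE)
    then show "v \<in> h ` E" using j(2)[OF \<open>v \<in> E\<close>] by (intro image_eqI[of _ _ w]) (simp_all add: h_def)
  qed (use hE in auto)
  have hh: "h holomorphic_on E"
    unfolding h_def using \<psi>h j(1) im\<psi> by (intro holomorphic_on_compose) auto
  have evE: "\<forall>\<^sub>F w in at_infinity. w \<in> E"
    unfolding E_def eventually_at_infinity by (auto intro!: exI[of _ 2])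
  have \<psi>inf: "filterlim \<psi> at_infinity at_infinity"
  proof -
    have "filterlim (\<lambda>w. \<psi> w / w * w) at_infinity at_infinity"
      using \<delta> by (intro tendsto_mult_filterlim_at_infinity[of _ "of_real \<delta>"] filterlim_ident) auto
    moreover have "\<forall>\<^sub>F w in at_infinity. \<psi> w / w * w = \<psi> w"
      using eventually_not_equal_at_infinity[of 0] by eventually_elim simp
    ultimately show ?thesis using filterlim_cong[OF refl refl] by force
  qed
  have hinf: "filterlim h at_infinity at_infinity"
    unfolding filterlim_at_infinity[OF order_refl]
  proof (intro allI impI)
    fix r :: real assume "0 < r"
    \<comment> \<open>Since |J v| \<le> \<gamma> (|v| + 1) + |c| outside the unit disc, |\<psi> w|
      \<ge> R forces |h w| \<ge> r.\<close>
    define R where "R = \<gamma> * (r + 1) + norm c + 1"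
    have "\<forall>\<^sub>F w in at_infinity. R \<le> norm (\<psi> w)"
      using \<psi>inf[unfolded filterlim_at_infinity[OF order_refl], rule_format, of R]  \<gamma> \<open>0 < r\<close>
      by (simp add: R_def add_pos_nonneg)
    with evE show "\<forall>\<^sub>F w in at_infinity. r \<le> norm (h w)"
    proof eventually_elim
      case (elim w)
      have nE: "1 < norm (h w)" using hE(1)[OF elim(1)] by (simp add: E_def)
      have "norm (g\<^sup>2 / h w) \<le> 1"
      proof -
        have "norm (g\<^sup>2) \<le> 1" using g by (simp add: norm_power power_le_one)
        then show ?thesis using nE by (simp add: norm_divide divide_le_eq)
      qed
      then have "norm (h w + g\<^sup>2 / h w) \<le> norm (h w) + 1" by norm
      then have "\<gamma> * norm (h w + g\<^sup>2 / h w) \<le> \<gamma> * (norm (h w) + 1)"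
        using \<gamma> by (intro mult_left_mono) auto
      moreover have "norm (J (h w)) \<le> norm (of_real \<gamma> * (h w + g\<^sup>2 / h w)) + norm c"
        unfolding J_def by (rule norm_triangle_ineq)
      moreover have "norm (of_real \<gamma> * (h w + g\<^sup>2 / h w)) = \<gamma> * norm (h w + g\<^sup>2 / h w)"
        using \<gamma> by (simp add: norm_mult)
      ultimately have "R \<le> \<gamma> * (norm (h w) + 1) + norm c"
        using elim(2) unfolding hE(2)[OF elim(1)] by linarith
      then have "\<gamma> * r \<le> \<gamma> * norm (h w)" by (simp add: R_def algebra_simps)
      then show ?case using \<gamma> by simp
    qed
  qed
  have hw: "((\<lambda>w. w / h w) \<longlongrightarrow> of_real (\<gamma> / \<delta>)) at_infinity"
  proof -
    have 1: "((\<lambda>w. J (h w) / h w) \<longlongrightarrow> of_real \<gamma>) at_infinity"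
      using filterlim_compose[OF joukowski_tendsto[of \<gamma> g c] hinf] by (simp add: J_def)
    have "((\<lambda>w. (J (h w) / h w) / (\<psi> w / w)) \<longlongrightarrow> of_real \<gamma> / of_real \<delta>) at_infinity"
      using \<delta>(1) by (intro tendsto_divide 1 \<delta>(2)) auto
    moreover have "\<forall>\<^sub>F w in at_infinity. norm (\<psi> w) \<ge> 1"
      using \<psi>inf[unfolded filterlim_at_infinity[OF order_refl]] by simp
    then have "\<forall>\<^sub>F w in at_infinity. (J (h w) / h w) / (\<psi> w / w) = w / h w"
      using evE by eventually_elim (use hE(2) in auto)
    ultimately show ?thesis by (auto elim: Lim_transform_eventually)
  qed
  \<comment> \<open>The conjugate of \<open>h\<close> by inversion; the value 0 at 0 fills a
    removable singularity, because \<open>h\<close> tends to infinity.\<close>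
  define k where "k z = (if z = 0 then 0 else inverse (h (inverse z)))" for z
  have iE: "inverse z \<in> E" if "norm z < 1" "z \<noteq> 0" for z
    using that by (simp add: E_def norm_inverse one_less_inverse)
  have khol: "k holomorphic_on ball 0 1"
  proof -
    have "h holomorphic_on inverse ` (ball 0 1 - {0})"
      using hh by (rule holomorphic_on_subset) (rule image_subsetI, rule iE, auto)
    then have "(\<lambda>z. inverse (h (inverse z))) holomorphic_on ball 0 1 - {0}"
      using hE(1) E0 iE
      by (intro holomorphic_on_inverse holomorphic_on_compose[of inverse _ h, unfolded o_def] holomorphic_intros)
        (force simp: )+
    moreover have "((\<lambda>z. inverse (h (inverse z))) \<longlongrightarrow> 0) (at 0)"
      by (rule filterlim_compose[OF tendsto_inverse_0])
        (rule filterlim_compose[OF hinf filterlim_inverse_at_infinity])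
    ultimately show ?thesis unfolding k_def using removable_singularity[OF _ open_ball] by blast
  qed
  have kz: "k z \<noteq> 0" "norm (k z) < 1" "inverse (k z) = h (inverse z)" if "norm z < 1" "z \<noteq> 0" for z
    using hE(1)[OF iE[OF that]] that by (auto simp: k_def E_def norm_inverse inverse_less_1_iff)
  have k0: "k z = 0 \<longleftrightarrow> z = 0" if "norm z < 1" for z
    using kz(1)[OF that] by (auto simp: k_def[of 0])
  have kinj: "inj_on k (ball 0 1)"
  proof (rule inj_onI)
    fix x y assume xy: "x \<in> ball 0 1" "y \<in> ball 0 1" "k x = k y"
    show "x = y"
    proof (cases "x = 0 \<or> y = 0")
      case True then show ?thesis using xy k0 unfolding mem_ball_0 by metis
    next
      case False
      then have "h (inverse x) = h (inverse y)" using xy kz(3)[of x] kz(3)[of y] by simp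
      then have "inverse x = inverse y"
        using inj_onD[OF injh, of "inverse x" "inverse y"] iE[of x] iE[of y] False xy by simp
      then show ?thesis by simp
    qed
  qed
  have kim: "k ` ball 0 1 = ball 0 1"
  proof (intro equalityI subsetI)
    fix x assume "x \<in> k ` ball 0 1"
    then show "x \<in> ball 0 1" using kz(2) by (force simp: k_def[of 0])
  next
    fix x :: complex assume x: "x \<in> ball 0 1"
    show "x \<in> k ` ball 0 1"
    proof (cases "x = 0")
      case True then show ?thesis by (auto simp: k_def intro!: image_eqI[of _ _ 0])
    next
      case False
      then obtain v where v: "v \<in> E" "inverse x = h v" using imh iE[of x] x by (metis imageE mem_ball_0)
      have "norm (inverse v) < 1" "v \<noteq> 0" using v(1) E0 by (auto simp: E_def norm_inverse inverse_less_1_iff)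
      moreover have "k (inverse v) = x" using v E0 by (auto simp: k_def simp flip: v(2))
      ultimately show ?thesis by (intro image_eqI[of _ _ "inverse v"]) auto
    qed
  qed
  obtain \<alpha> where \<alpha>: "norm \<alpha> = 1" "\<And>z. norm z < 1 \<Longrightarrow> k z = \<alpha> * z"
    using inj_disc_automorphism[OF khol kinj kim] by (auto simp: k_def[of 0])
  have ev: "w / h w = \<alpha>" if "w \<in> E" for w
  proof -
    have "norm (inverse w) < 1" "w \<noteq> 0" using that E0 by (auto simp: E_def norm_inverse inverse_less_1_iff)
    then show ?thesis using \<alpha>(2)[of "inverse w"] by (auto simp: k_def field_simps)
  qed
  have "((\<lambda>w. \<alpha>) \<longlongrightarrow> of_real (\<gamma> / \<delta>)) (at_infinity :: complex filter)"
    using hw by (rule Lim_transform_eventually) (use evE ev in \<open>auto elim!: eventually_mono\<close>)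
  \<comment> \<open>A number of modulus 1 that equals the positive quotient \<gamma>/\<delta> is
    1.\<close>
  then have "\<alpha> = of_real (\<gamma> / \<delta>)" by (simp only: tendsto_const_iff[OF trivial_limit_at_infinity])
  then have "\<alpha> = 1" using \<alpha>(1) \<gamma> \<delta>(1) by (simp add: norm_divide)
  moreover have "w \<in> E" using w by (simp add: E_def)
  ultimately have "h w = w" using ev[of w] E0 by (metis div_by_0 divide_eq_1_iff zero_neq_one)
  then show ?thesis using hE(2)[OF \<open>w \<in> E\<close>] by (simp add: J_def)
qed

text \<open>Symmetry yields a second representation of the same ellipse, with \<open>g\<close> and
  \<open>c\<close> conjugated, so \<psi> is given by both formulas and their coefficients agree.
  Only g^2 = G has to be real: it is negative if the major axis is vertical.\<close>

lemma ellipse_exterior_map: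
  assumes "filled_ellipse \<Omega>" and sym: "cnj ` \<Omega> = \<Omega>" and \<psi>: "exterior_conformal_map \<Omega> \<psi>"
  obtains \<gamma> G c :: real where "0 < \<gamma>" "\<bar>G\<bar> < 1" "of_real c \<in> \<Omega>" "convex \<Omega>" "closed \<Omega>"
    "\<And>w. 1 < norm w \<Longrightarrow> \<psi> w = of_real \<gamma> * (w + of_real G / w) + of_real c"
    "\<And>z w. z \<in> \<Omega> \<Longrightarrow> norm w = 1 \<Longrightarrow>
       0 \<le> Re (cnj (w - of_real G / w) * (w + of_real G / w - (z - of_real c) / of_real \<gamma>))"
proof -
  obtain \<gamma> g c where \<gamma>: "0 < \<gamma>" and g: "norm g < 1" and Om: "\<Omega> = joukowski_ellipse \<gamma> g c"
    using filled_ellipse_joukowski assms(1) by blast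
  have Om': "\<Omega> = joukowski_ellipse \<gamma> (cnj g) (cnj c)"
  proof -
    have "z \<in> joukowski_ellipse \<gamma> (cnj g) (cnj c) \<longleftrightarrow> cnj z \<in> joukowski_ellipse \<gamma> g c" for z
    proof -
      have "dist (cnj z) x = dist z (cnj x)" for x
        by (metis complex_cnj_cnj complex_cnj_diff complex_mod_cnj dist_norm)
      then show ?thesis by (simp add: joukowski_ellipse_def)
    qed
    then have "joukowski_ellipse \<gamma> (cnj g) (cnj c) = cnj ` \<Omega>"
      unfolding Om by (force simp: image_iff intro: bexI[of _ "cnj _"])
    then show ?thesis using sym by simp
  qed
  have e1: "\<psi> w = of_real \<gamma> * (w + g\<^sup>2 / w) + c" if "1 < norm w" for w
    using exterior_conformal_map_joukowski[OF \<gamma> g \<psi>[unfolded Om] that] .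
  have e2: "\<psi> w = of_real \<gamma> * (w + (cnj g)\<^sup>2 / w) + cnj c" if "1 < norm w" for w
    using exterior_conformal_map_joukowski[OF \<gamma> _ \<psi>[unfolded Om'] that] g by simp
  \<comment> \<open>The two formulas are compared at w = 2 and w = -2; adding the results isolates
    \<open>c\<close>, and then g^2 follows.\<close>
  have d1: "of_real \<gamma> * g\<^sup>2 / 2 + c = of_real \<gamma> * (cnj g)\<^sup>2 / 2 + cnj c"
    using e1[of 2] e2[of 2] by (simp add: algebra_simps)
  have d2: "- (of_real \<gamma> * g\<^sup>2 / 2) + c = - (of_real \<gamma> * (cnj g)\<^sup>2 / 2) + cnj c"
    using e1[of "-2"] e2[of "-2"] by (simp add: algebra_simps)
  have "2 * c = 2 * cnj c" using arg_cong2[OF d1 d2, of "(+)"] by simp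
  then have "cnj c = c" by simp
  then obtain c' where c: "c = of_real c'" by (metis Reals_cases Reals_cnj_iff)
  have "of_real \<gamma> * g\<^sup>2 = of_real \<gamma> * (cnj g)\<^sup>2" using d1 \<open>cnj c = c\<close> by simp
  then have "cnj (g\<^sup>2) = g\<^sup>2" using \<gamma> by simp
  then obtain G where G: "g\<^sup>2 = of_real G" by (metis Reals_cases Reals_cnj_iff)
  have aG: "\<bar>G\<bar> = (norm g)\<^sup>2" using G by (metis norm_of_real norm_power)
  show ?thesis
  proof
    show "\<bar>G\<bar> < 1" using aG g by (simp add: power_less_one_iff abs_square_less_1)
    show "of_real c' \<in> \<Omega>"
    proof -
      \<comment> \<open>The centre has focal sum 4 \<gamma> |g|, to be compared with 2 \<gamma> (1 +
        |g|^2).\<close>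
      have "0 \<le> (1 - norm g)\<^sup>2" by simp
      then have "2 * norm g \<le> 1 + (norm g)\<^sup>2" by (simp add: power2_diff)
      then show ?thesis unfolding Om joukowski_ellipse_def using \<gamma> by (simp add: c dist_norm norm_mult)
    qed
    show "convex \<Omega>" "closed \<Omega>" unfolding Om by (rule convex_joukowski_ellipse closed_joukowski_ellipse)+
    show "\<psi> w = of_real \<gamma> * (w + of_real G / w) + of_real c'" if "1 < norm w" for w
      using e1[OF that] by (simp add: G c)
    show "0 \<le> Re (cnj (w - of_real G / w) * (w + of_real G / w - (z - of_real c') / of_real \<gamma>))"
      if z: "z \<in> \<Omega>" and w: "norm w = 1" for z w
    proof -
      obtain v where v: "norm g \<le> norm v" "(z - c) / of_real \<gamma> = v + g\<^sup>2 / v" by (rule joukowski_surj)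
      then have "z = of_real \<gamma> * (v + g\<^sup>2 / v) + c" using \<gamma> by (simp add: field_simps)
      then have "norm v \<le> 1" using joukowski_in_ellipse_iff[OF \<gamma> g v(1), of c] z Om by simp
      moreover have "\<bar>G\<bar> \<le> (norm v)\<^sup>2" using v(1) by (simp add: aG power_mono)
      ultimately show ?thesis
        using joukowski_support[OF _ w, of G v] aG g v(2) by (simp add: G c power_less_one_iff abs_square_less_1)
    qed
  qed (fact \<gamma>)
qed

subsection \<open>The Galerkin error\<close>

lemma scalar_prod_self_ge_0: "0 \<le> (v :: real vec) \<bullet> v"
  by (simp add: scalar_prod_def sum_nonneg)

lemma euclid_norm_ge_0: "0 \<le> euclid_norm v"
  by (simp add: euclid_norm_def scalar_prod_self_ge_0)

lemma euclid_norm_power2: "(euclid_norm v)\<^sup>2 = v \<bullet> v"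
  by (simp add: euclid_norm_def scalar_prod_self_ge_0)

lemma scalar_prod_self_eq_0: "(v :: real vec) \<in> carrier_vec n \<Longrightarrow> v \<bullet> v = 0 \<longleftrightarrow> v = 0\<^sub>v n"
  using conjugate_square_eq_0_vec[of v n] by (simp add: vec_conjugate_real)

lemma euclid_norm_Cauchy_Schwarz:
  assumes "v \<in> carrier_vec n" "w \<in> carrier_vec n"
  shows "\<bar>v \<bullet> w\<bar> \<le> euclid_norm v * euclid_norm w"
proof -
  have "(v \<bullet> w)\<^sup>2 \<le> (v \<bullet> v) * (w \<bullet> w)"
    using Cauchy_Schwarz_ineq_sum[of "\<lambda>i. v $ i" "\<lambda>i. w $ i" "{0..<n}"] assms
    by (simp add: scalar_prod_def flip: power2_eq_square)
  also have "\<dots> = (euclid_norm v * euclid_norm w)\<^sup>2"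
    by (simp add: power_mult_distrib euclid_norm_power2)
  finally show ?thesis
    using abs_le_square_iff[of "v \<bullet> w" "euclid_norm v * euclid_norm w"]
    by (simp add: euclid_norm_ge_0)
qed

lemma euclid_norm_smult: "euclid_norm (a \<cdot>\<^sub>v v) = \<bar>a\<bar> * euclid_norm v"
  by (simp add: euclid_norm_def real_sqrt_mult flip: mult.assoc power2_eq_square)

lemma euclid_norm_triangle:
  assumes v: "v \<in> carrier_vec n" and w: "w \<in> carrier_vec n"
  shows "euclid_norm (v + w) \<le> euclid_norm v + euclid_norm w"
proof (rule power2_le_imp_le)
  have "(euclid_norm (v + w))\<^sup>2 = v \<bullet> v + w \<bullet> w + 2 * (v \<bullet> w)"
    using v w comm_scalar_prod[OF v w]
    by (simp add: euclid_norm_power2 add_scalar_prod_distrib[of _ n] scalar_prod_add_distrib[of _ n])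
  also have "\<dots> \<le> v \<bullet> v + w \<bullet> w + 2 * (euclid_norm v * euclid_norm w)"
    using euclid_norm_Cauchy_Schwarz[OF v w] by simp
  also have "\<dots> = (euclid_norm v + euclid_norm w)\<^sup>2"
    by (simp add: power2_sum euclid_norm_power2)
  finally show "(euclid_norm (v + w))\<^sup>2 \<le> (euclid_norm v + euclid_norm w)\<^sup>2" .
qed (simp add: euclid_norm_ge_0)

text \<open>\<open>minv\<close> takes \<open>the\<close> of an option, so existence of the inverse
  comes first: a trivial kernel gives a nonzero determinant.\<close>

lemma minv_inverse:
  assumes M: "M \<in> carrier_mat n n"
    and inj: "\<And>v. v \<in> carrier_vec n \<Longrightarrow> M *\<^sub>v v = 0\<^sub>v n \<Longrightarrow> v = 0\<^sub>v n"
  shows "minv M \<in> carrier_mat n n" "M * minv M = 1\<^sub>m n" "minv M * M = 1\<^sub>m n"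
proof -
  have "det M \<noteq> 0" using inj det_0_iff_vec_prod_zero_field[OF M] by blast
  then have "M \<in> Units (ring_mat TYPE(real) n ())" by (rule det_non_zero_imp_unit[OF M])
  then obtain B where "mat_inverse M = Some B"
    using mat_inverse(1)[OF M, where b = "()"] by (cases "mat_inverse M") auto
  then show "minv M \<in> carrier_mat n n" "M * minv M = 1\<^sub>m n" "minv M * M = 1\<^sub>m n"
    using mat_inverse(2)[OF M] by (auto simp: minv_def)
qed

lemma field_of_values_mem:
  fixes M :: "real mat" and u :: "nat \<Rightarrow> complex"
  assumes M: "M \<in> carrier_mat N N" and u: "i < N" "u i \<noteq> 0"
  shows "(\<Sum>i\<in>{0..<N}. mat_act N (\<lambda>i j. of_real (M $$ (i, j))) u i * cnj (u i))
      / of_real (\<Sum>i\<in>{0..<N}. (norm (u i))\<^sup>2) \<in> field_of_values (map_mat complex_of_real M)"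
proof -
  define x where "x = vec N u"
  have x: "x \<in> carrier_vec N" by (simp add: x_def)
  have x0: "x \<noteq> 0\<^sub>v N" using u by (metis index_vec index_zero_vec(1) x_def)
  have "x \<bullet>c x = of_real (\<Sum>i\<in>{0..<N}. (norm (u i))\<^sup>2)"
    by (simp add: scalar_prod_def x_def complex_norm_square flip: of_real_power)
  moreover have "(map_mat complex_of_real M *\<^sub>v x) \<bullet>c x =
     (\<Sum>i\<in>{0..<N}. mat_act N (\<lambda>i j. of_real (M $$ (i, j))) u i * cnj (u i))"
    using M by (simp add: scalar_prod_def x_def mat_act_def)
  moreover have "((map_mat complex_of_real M *\<^sub>v x) \<bullet>c x) / (x \<bullet>c x) \<in> field_of_values (map_mat complex_of_real M)"
    unfolding field_of_values_def using x x0 M by auto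
  ultimately show ?thesis by simp
qed

lemma field_of_values_real_mem:
  fixes M :: "real mat"
  assumes M: "M \<in> carrier_mat N N" and v: "v \<in> carrier_vec N" "v \<noteq> 0\<^sub>v N"
  shows "complex_of_real (((M *\<^sub>v v) \<bullet> v) / (v \<bullet> v)) \<in> field_of_values (map_mat complex_of_real M)"
proof -
  obtain i where i: "i < N" "v $ i \<noteq> 0"
    using v by (metis carrier_vecD eq_vecI index_zero_vec)
  have "(\<Sum>i\<in>{0..<N}. mat_act N (\<lambda>i j. of_real (M $$ (i, j))) (\<lambda>i. of_real (v $ i)) i * cnj (complex_of_real (v $ i)))
     = complex_of_real ((M *\<^sub>v v) \<bullet> v)"
    using v M by (simp add: scalar_prod_def mat_act_def)
  moreover have "(\<Sum>i\<in>{0..<N}. (norm (complex_of_real (v $ i)))\<^sup>2) = v \<bullet> v"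
    using v by (simp add: scalar_prod_def power2_eq_square)
  ultimately show ?thesis
    using field_of_values_mem[OF M i(1), of "\<lambda>i. of_real (v $ i)"] i(2) by simp
qed

section \<open>Spans, matrix shifts and Krylov vectors\<close>

lemma vec_span_mem:
  assumes "S \<subseteq> carrier_vec N" "s \<in> S"
  shows "s \<in> vec_span N S"
proof -
  interpret vec_space "TYPE(real)" N .
  show ?thesis using in_own_span[of S] assms unfolding vec_span_def by auto
qed

text \<open>The orthogonal complement of \<open>r\<close> is a subspace containing \<open>S\<close>,
  hence also its span.\<close>

lemma vec_span_orthogonal:
  assumes S: "S \<subseteq> carrier_vec N" and r: "r \<in> carrier_vec N"
    and orth: "\<And>s. s \<in> S \<Longrightarrow> r \<bullet> s = 0" and v: "v \<in> vec_span N S"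
  shows "r \<bullet> v = 0"
proof -
  interpret vec_space "TYPE(real)" N .
  define W where "W = {v \<in> carrier_vec N. r \<bullet> v = 0}"
  have "submodule class_ring W V"
    unfolding submodule_def W_def using r module_axioms
    by (auto simp: scalar_prod_add_distrib[of _ N])
  moreover have "S \<subseteq> W" using S orth by (auto simp: W_def)
  ultimately have "span S \<subseteq> W" by (intro span_is_subset)
  then show ?thesis using v unfolding vec_span_def W_def by auto
qed

lemma smult_mat_mult_vec:
  fixes M :: "real mat"
  assumes "M \<in> carrier_mat n k" "v \<in> carrier_vec k"
  shows "(a \<cdot>\<^sub>m M) *\<^sub>v v = a \<cdot>\<^sub>v (M *\<^sub>v v)"
  using assms by (intro eq_vecI) auto

lemma mult_mat_unit_vec:
  fixes M :: "real mat"
  assumes "M \<in> carrier_mat n k" "j < k"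
  shows "M *\<^sub>v unit_vec k j = col M j"
  using assms by (intro eq_vecI) auto

lemma shift_mat_mult_vec:
  fixes Z :: "real mat"
  assumes Z: "Z \<in> carrier_mat N N" and v: "v \<in> carrier_vec N"
  shows "(a \<cdot>\<^sub>m (Z - c \<cdot>\<^sub>m 1\<^sub>m N)) *\<^sub>v v = a \<cdot>\<^sub>v (Z *\<^sub>v v - c \<cdot>\<^sub>v v)"
proof -
  have "(a \<cdot>\<^sub>m (Z - c \<cdot>\<^sub>m 1\<^sub>m N)) *\<^sub>v v = a \<cdot>\<^sub>v ((Z - c \<cdot>\<^sub>m 1\<^sub>m N) *\<^sub>v v)"
    using Z v by (intro smult_mat_mult_vec[of _ N N]) auto
  also have "(Z - c \<cdot>\<^sub>m 1\<^sub>m N) *\<^sub>v v = Z *\<^sub>v v - (c \<cdot>\<^sub>m 1\<^sub>m N) *\<^sub>v v"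
    using Z v by (intro minus_mult_distrib_mat_vec[of _ N N]) auto
  also have "(c \<cdot>\<^sub>m 1\<^sub>m N) *\<^sub>v v = c \<cdot>\<^sub>v v"
    using v by (subst smult_mat_mult_vec[of _ N N]) auto
  finally show ?thesis .
qed

text \<open>The vector q_n(T) b for the divided difference q_n(x) = (D_n(\<zeta>) - D_n(x)) /
  (\<zeta> - x). The recurrence of D_n induces this one, starting with q_0 = 0 and q_1 = 1. Since
  q_n has degree below n, the vector lies in the n-th Krylov space.\<close>

fun dickson_quot_vec :: "real mat \<Rightarrow> real \<Rightarrow> real \<Rightarrow> real vec \<Rightarrow> nat \<Rightarrow> real vec" where
  "dickson_quot_vec T G \<zeta> b 0 = 0 \<cdot>\<^sub>v b"
| "dickson_quot_vec T G \<zeta> b (Suc 0) = b"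
| "dickson_quot_vec T G \<zeta> b (Suc (Suc n)) =
     poly (dickson G (Suc n)) \<zeta> \<cdot>\<^sub>v b + T *\<^sub>v dickson_quot_vec T G \<zeta> b (Suc n)
       - G \<cdot>\<^sub>v dickson_quot_vec T G \<zeta> b n"

lemma dickson_quot_vec_carrier [simp]:
  assumes "T \<in> carrier_mat N N" "b \<in> carrier_vec N"
  shows "dickson_quot_vec T G \<zeta> b n \<in> carrier_vec N"
  by (induction n rule: induct_nat_012) (use assms in \<open>auto intro: mult_mat_vec_carrier\<close>)

lemma dickson_quot_vec:
  assumes T: "T \<in> carrier_mat N N" and b: "b \<in> carrier_vec N"
  shows "\<zeta> \<cdot>\<^sub>v dickson_quot_vec T G \<zeta> b n - T *\<^sub>v dickson_quot_vec T G \<zeta> b n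
     = poly (dickson G n) \<zeta> \<cdot>\<^sub>v b - dickson_vec T G b n"
proof (induction n rule: induct_nat_012)
  case 0
  show ?case using T b by (intro eq_vecI) (auto simp: mult_mat_vec[OF T b])
next
  case 1
  show ?case using T b by (intro eq_vecI) auto
next
  case (ge2 n)
  define q0 q1 where "q0 = dickson_quot_vec T G \<zeta> b n" and "q1 = dickson_quot_vec T G \<zeta> b (Suc n)"
  define p0 p1 where "p0 = dickson_vec T G b n" and "p1 = dickson_vec T G b (Suc n)"
  define P0 P1 where "P0 = poly (dickson G n) \<zeta>" and "P1 = poly (dickson G (Suc n)) \<zeta>"
  have c: "q0 \<in> carrier_vec N" "q1 \<in> carrier_vec N" "p0 \<in> carrier_vec N" "p1 \<in> carrier_vec N"
    using dickson_quot_vec_carrier[OF T b] dickson_vec_carrier[OF T b]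
    unfolding q0_def q1_def p0_def p1_def by blast+
  have mc: "T *\<^sub>v v \<in> carrier_vec N" if "v \<in> carrier_vec N" for v
    using T that by (rule mult_mat_vec_carrier)
  note IH0 = ge2(1)[folded q0_def p0_def P0_def] and IH1 = ge2(2)[folded q1_def p1_def P1_def]
  have TIH: "\<zeta> \<cdot>\<^sub>v (T *\<^sub>v q1) - T *\<^sub>v (T *\<^sub>v q1) = P1 \<cdot>\<^sub>v (T *\<^sub>v b) - T *\<^sub>v p1"
    using arg_cong[OF IH1, of "\<lambda>v. T *\<^sub>v v"] c b
    by (simp add: mult_minus_distrib_mat_vec[OF T] mult_mat_vec[OF T] mc)
  have Tq: "T *\<^sub>v (P1 \<cdot>\<^sub>v b + T *\<^sub>v q1 - G \<cdot>\<^sub>v q0) = P1 \<cdot>\<^sub>v (T *\<^sub>v b) + T *\<^sub>v (T *\<^sub>v q1) - G \<cdot>\<^sub>v (T *\<^sub>v q0)"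
    using c b by (simp add: mult_minus_distrib_mat_vec[OF T] mult_add_distrib_mat_vec[OF T] mult_mat_vec[OF T] mc)
  have "\<zeta> \<cdot>\<^sub>v (P1 \<cdot>\<^sub>v b + T *\<^sub>v q1 - G \<cdot>\<^sub>v q0) - (P1 \<cdot>\<^sub>v (T *\<^sub>v b) + T *\<^sub>v (T *\<^sub>v q1) - G \<cdot>\<^sub>v (T *\<^sub>v q0))
     = (\<zeta> * P1 - G * P0) \<cdot>\<^sub>v b - (T *\<^sub>v p1 - G \<cdot>\<^sub>v p0)" (is "?L = ?R")
  proof (rule eq_vecI)
    have d: "dim_vec b = N" "dim_vec q0 = N" "dim_vec q1 = N" "dim_vec p0 = N" "dim_vec p1 = N"
      "dim_vec (T *\<^sub>v v) = N" for v
      using c b T by auto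
    show "dim_vec ?L = dim_vec ?R" using d by simp
    fix i assume "i < dim_vec ?R"
    then have i: "i < N" using d by simp
    have 1: "\<zeta> * (T *\<^sub>v q1) $ i - (T *\<^sub>v (T *\<^sub>v q1)) $ i = P1 * (T *\<^sub>v b) $ i - (T *\<^sub>v p1) $ i"
      using arg_cong[OF TIH, of "\<lambda>v :: real vec. v $ i"] i d by (simp del: index_mult_mat_vec)
    have 2: "\<zeta> * q0 $ i - (T *\<^sub>v q0) $ i = P0 * b $ i - p0 $ i"
      using arg_cong[OF IH0, of "\<lambda>v :: real vec. v $ i"] i d by (simp del: index_mult_mat_vec)
    have "?L $ i = \<zeta> * P1 * b $ i - P1 * (T *\<^sub>v b) $ i + (\<zeta> * (T *\<^sub>v q1) $ i - (T *\<^sub>v (T *\<^sub>v q1)) $ i)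
        - G * (\<zeta> * q0 $ i - (T *\<^sub>v q0) $ i)"
      using i d by (simp del: index_mult_mat_vec add: algebra_simps)
    also have "\<dots> = ?R $ i" unfolding 1 2
      using i d by (simp del: index_mult_mat_vec add: algebra_simps)
    finally show "?L $ i = ?R $ i" .
  qed
  then show ?case unfolding dickson_quot_vec.simps dickson_vec.simps dickson.simps
    using Tq by (simp add: q0_def q1_def p0_def p1_def P0_def P1_def)
qed

text \<open>The vector involves only powers of \<open>Z\<close> below n + i applied to
  \<open>b\<close>. The factor Z^i makes the induction work, because multiplication by
  \<open>T\<close> raises the power of \<open>Z\<close>.\<close>

lemma dickson_quot_vec_orthogonal:
  fixes Z :: "real mat"
  assumes Z: "Z \<in> carrier_mat N N" and b: "b \<in> carrier_vec N" and r: "r \<in> carrier_vec N"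
    and T: "T = a \<cdot>\<^sub>m (Z - c \<cdot>\<^sub>m 1\<^sub>m N)"
    and orth: "\<And>i. i < m \<Longrightarrow> r \<bullet> ((Z ^\<^sub>m i) *\<^sub>v b) = 0"
  shows "n + i \<le> m \<Longrightarrow> r \<bullet> ((Z ^\<^sub>m i) *\<^sub>v dickson_quot_vec T G \<zeta> b n) = 0"
proof (induction n arbitrary: i rule: induct_nat_012)
  have Zi: "Z ^\<^sub>m i \<in> carrier_mat N N" for i using Z by (rule pow_carrier_mat)
  {
    case 0
    then show ?case using b r Zi[of i] by (simp add: mult_mat_vec[OF Zi])
  next
    case 1
    then show ?case using orth[of i] by simp
  next
    case (ge2 n)
    define q0 q1 where "q0 = dickson_quot_vec T G \<zeta> b n" and "q1 = dickson_quot_vec T G \<zeta> b (Suc n)"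
    define P1 where "P1 = poly (dickson G (Suc n)) \<zeta>"
    have Tc: "T \<in> carrier_mat N N" using Z by (auto simp: T)
    have q: "q0 \<in> carrier_vec N" "q1 \<in> carrier_vec N"
      using dickson_quot_vec_carrier[OF Tc b] unfolding q0_def q1_def by blast+
    have mc: "M *\<^sub>v v \<in> carrier_vec N" if "M \<in> carrier_mat N N" "v \<in> carrier_vec N" for M v
      using that by (rule mult_mat_vec_carrier)
    have Tq: "T *\<^sub>v q1 = a \<cdot>\<^sub>v (Z *\<^sub>v q1 - c \<cdot>\<^sub>v q1)"
      unfolding T using shift_mat_mult_vec[OF Z q(2)] .
    have ZZ: "(Z ^\<^sub>m i) *\<^sub>v (Z *\<^sub>v q1) = (Z ^\<^sub>m Suc i) *\<^sub>v q1"
      by (simp only: pow_mat.simps assoc_mult_mat_vec[OF Zi Z q(2)])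
    have "(Z ^\<^sub>m i) *\<^sub>v (P1 \<cdot>\<^sub>v b + a \<cdot>\<^sub>v (Z *\<^sub>v q1 - c \<cdot>\<^sub>v q1) - G \<cdot>\<^sub>v q0)
       = P1 \<cdot>\<^sub>v ((Z ^\<^sub>m i) *\<^sub>v b) + a \<cdot>\<^sub>v ((Z ^\<^sub>m Suc i) *\<^sub>v q1 - c \<cdot>\<^sub>v ((Z ^\<^sub>m i) *\<^sub>v q1)) - G \<cdot>\<^sub>v ((Z ^\<^sub>m i) *\<^sub>v q0)"
      using q b mc[OF Z] unfolding ZZ[symmetric]
      by (simp add: mult_minus_distrib_mat_vec[OF Zi] mult_add_distrib_mat_vec[OF Zi] mult_mat_vec[OF Zi])
    moreover have "r \<bullet> \<dots> = P1 * (r \<bullet> ((Z ^\<^sub>m i) *\<^sub>v b)) + a * (r \<bullet> ((Z ^\<^sub>m Suc i) *\<^sub>v q1) - c * (r \<bullet> ((Z ^\<^sub>m i) *\<^sub>v q1)))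
        - G * (r \<bullet> ((Z ^\<^sub>m i) *\<^sub>v q0))"
      using q b r mc[OF Zi]
      by (simp add: scalar_prod_add_distrib[of _ N] scalar_prod_minus_distrib[of _ N] del: pow_mat.simps)
    moreover have "r \<bullet> ((Z ^\<^sub>m i) *\<^sub>v b) = 0" using orth[of i] ge2.prems by simp
    moreover have "r \<bullet> ((Z ^\<^sub>m Suc i) *\<^sub>v q1) = 0" "r \<bullet> ((Z ^\<^sub>m i) *\<^sub>v q1) = 0" "r \<bullet> ((Z ^\<^sub>m i) *\<^sub>v q0) = 0"
      using ge2.IH(2)[of "Suc i"] ge2.IH(2)[of i] ge2.IH(1)[of i] ge2.prems
      unfolding q0_def q1_def by auto
    ultimately show ?case unfolding dickson_quot_vec.simps by (simp add: Tq flip: q0_def q1_def P1_def)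
  }
qed

text \<open>Cea's lemma, with coercivity used twice: for \<open>e\<close>, where Galerkin
  orthogonality replaces one \<open>e\<close> by \<open>h\<close>, and for \<open>h\<close>, to pass
  from \<open>h\<close> to its residual. The absolute value in the coercivity condition admits forms
  of either sign.\<close>

lemma cea:
  assumes e: "e \<in> carrier_vec n" and h: "h \<in> carrier_vec n" and B: "B \<in> carrier_mat n n"
    and \<kappa>: "0 < \<kappa>" and L: "0 \<le> L"
    and coercive: "\<And>v. v \<in> carrier_vec n \<Longrightarrow> \<kappa> * (v \<bullet> v) \<le> \<bar>(B *\<^sub>v v) \<bullet> v\<bar>"
    and Be: "euclid_norm (B *\<^sub>v e) \<le> L * euclid_norm e"
    and orth: "(B *\<^sub>v e) \<bullet> e = (B *\<^sub>v e) \<bullet> h"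
  shows "euclid_norm e \<le> L / \<kappa>\<^sup>2 * euclid_norm (B *\<^sub>v h)"
proof -
  have Bc: "B *\<^sub>v v \<in> carrier_vec n" if "v \<in> carrier_vec n" for v
    using B that by (rule mult_mat_vec_carrier)
  \<comment> \<open>Cancels a norm that may be zero.\<close>
  have cancel: "x \<le> y" if "x * z \<le> y * z" "0 \<le> z" "z = 0 \<Longrightarrow> x \<le> y" for x y z :: real
    using that by (cases "z = 0") auto
  have "\<kappa> * euclid_norm h * euclid_norm h \<le> euclid_norm (B *\<^sub>v h) * euclid_norm h"
    using coercive[OF h] euclid_norm_Cauchy_Schwarz[OF Bc[OF h] h] euclid_norm_power2[of h]
    by (simp add: power2_eq_square mult.assoc)
  then have 1: "\<kappa> * euclid_norm h \<le> euclid_norm (B *\<^sub>v h)"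
    by (rule cancel) (simp_all add: euclid_norm_ge_0)
  have "\<kappa> * euclid_norm e * euclid_norm e \<le> euclid_norm (B *\<^sub>v e) * euclid_norm h"
    using coercive[OF e] euclid_norm_Cauchy_Schwarz[OF Bc[OF e] h] euclid_norm_power2[of e] orth
    by (simp add: power2_eq_square mult.assoc)
  also have "\<dots> \<le> L * euclid_norm e * euclid_norm h"
    using Be by (intro mult_right_mono) (auto simp: euclid_norm_ge_0)
  finally have "\<kappa> * euclid_norm e * euclid_norm e \<le> L * euclid_norm h * euclid_norm e"
    by (simp add: ac_simps)
  then have 2: "\<kappa> * euclid_norm e \<le> L * euclid_norm h"
    by (rule cancel) (use L in \<open>simp_all add: euclid_norm_ge_0\<close>)
  have "\<kappa> * (\<kappa> * euclid_norm e) \<le> \<kappa> * (L * euclid_norm h)" using 2 \<kappa> by simp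
  also have "\<dots> = L * (\<kappa> * euclid_norm h)" by simp
  also have "\<dots> \<le> L * euclid_norm (B *\<^sub>v h)" using 1 L by (rule mult_left_mono)
  finally show ?thesis using \<kappa> by (simp add: field_simps power2_eq_square)
qed

text \<open>If z is the Rayleigh quotient of \<open>Z\<close> at \<open>u\<close>, then (z -
  c)/\<gamma> is that of T = (Z - cI)/\<gamma>. The support inequality at z, multiplied by |u|^2, is
  the half-plane condition for T.\<close>

lemma dickson_vec_norm_field_of_values:
  fixes G \<gamma> c :: real
  assumes Z: "Z \<in> carrier_mat N N" and \<gamma>: "0 < \<gamma>" and G: "\<bar>G\<bar> < 1" and m: "0 < m"
    and fov: "field_of_values (map_mat complex_of_real Z) \<subseteq> \<Omega>"
    and supp: "\<And>z w. z \<in> \<Omega> \<Longrightarrow> norm w = 1 \<Longrightarrow>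
       0 \<le> Re (cnj (w - of_real G / w) * (w + of_real G / w - (z - of_real c) / of_real \<gamma>))"
    and x: "x \<in> carrier_vec N"
  shows "euclid_norm (dickson_vec ((1 / \<gamma>) \<cdot>\<^sub>m (Z - c \<cdot>\<^sub>m 1\<^sub>m N)) G x m) \<le> 8 * euclid_norm x"
proof (rule dickson_vec_norm[OF _ G m _ x])
  define T where "T = (1 / \<gamma>) \<cdot>\<^sub>m (Z - c \<cdot>\<^sub>m 1\<^sub>m N)"
  show "(1 / \<gamma>) \<cdot>\<^sub>m (Z - c \<cdot>\<^sub>m 1\<^sub>m N) \<in> carrier_mat N N" using Z by auto
  fix w :: complex and u :: "nat \<Rightarrow> complex" assume w: "norm w = 1"
  define a where "a = w + of_real G / w"
  define S where "S = (\<Sum>i\<in>{0..<N}. (norm (u i))\<^sup>2)"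
  define F where "F = (\<Sum>i\<in>{0..<N}. mat_act N (\<lambda>i j. of_real (Z $$ (i, j))) u i * cnj (u i))"
  have mt: "mat_act N (\<lambda>i j. of_real (T $$ (i, j))) u i
      = (mat_act N (\<lambda>i j. of_real (Z $$ (i, j))) u i - of_real c * u i) / of_real \<gamma>" if i: "i < N" for i
  proof -
    have "mat_act N (\<lambda>i j. of_real (T $$ (i, j))) u i
       = (\<Sum>j\<in>{0..<N}. (of_real (Z $$ (i, j)) * u j - (if j = i then of_real c * u j else 0)) / of_real \<gamma>)"
      unfolding mat_act_def T_def using Z i by (intro sum.cong refl) (auto simp: diff_divide_distrib algebra_simps)
    also have "\<dots> = (mat_act N (\<lambda>i j. of_real (Z $$ (i, j))) u i - of_real c * u i) / of_real \<gamma>"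
      using i by (simp add: mat_act_def sum_subtractf flip: sum_divide_distrib)
    finally show ?thesis .
  qed
  have "(\<Sum>i\<in>{0..<N}. (a * u i - mat_act N (\<lambda>i j. of_real (T $$ (i, j))) u i) * cnj (u i))
     = (\<Sum>i\<in>{0..<N}. (a + of_real c / of_real \<gamma>) * (u i * cnj (u i))
          - mat_act N (\<lambda>i j. of_real (Z $$ (i, j))) u i * cnj (u i) / of_real \<gamma>)"
    by (intro sum.cong refl) (simp add: mt algebra_simps diff_divide_distrib add_divide_distrib)
  also have "\<dots> = (a + of_real c / of_real \<gamma>) * of_real S - F / of_real \<gamma>"
    by (simp add: sum_subtractf S_def F_def complex_norm_square sum_distrib_left sum_divide_distrib flip: of_real_power)
  finally have sum: "(\<Sum>i\<in>{0..<N}. (a * u i - mat_act N (\<lambda>i j. of_real (T $$ (i, j))) u i) * cnj (u i))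
     = (a + of_real c / of_real \<gamma>) * of_real S - F / of_real \<gamma>" .
  have "0 \<le> Re (cnj (w - of_real G / w) * ((a + of_real c / of_real \<gamma>) * of_real S - F / of_real \<gamma>))"
  proof (cases "\<forall>i<N. u i = 0")
    \<comment> \<open>No Rayleigh quotient exists here, but both sums vanish.\<close>
    case True
    then have "S = 0" "F = 0" by (auto simp: S_def F_def)
    then show ?thesis by simp
  next
    case False
    then obtain i where i: "i < N" "u i \<noteq> 0" by auto
    have "0 < S" unfolding S_def by (rule sum_pos2[of _ i]) (use i in auto)
    define z where "z = F / of_real S"
    have "z \<in> \<Omega>" using field_of_values_mem[OF Z, of i u, OF i] fov unfolding z_def F_def S_def by blast
    have ReS: "Re (p * (q * of_real S)) = S * Re (p * q)" for p q by (simp add: algebra_simps)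
    from supp[OF \<open>z \<in> \<Omega>\<close> w] have "0 \<le> S * Re (cnj (w - of_real G / w) * (a - (z - of_real c) / of_real \<gamma>))"
      using \<open>0 < S\<close> by (simp add: a_def)
    also have "\<dots> = Re (cnj (w - of_real G / w) * ((a - (z - of_real c) / of_real \<gamma>) * of_real S))"
      by (rule ReS[symmetric])
    also have "(a - (z - of_real c) / of_real \<gamma>) * of_real S = (a + of_real c / of_real \<gamma>) * of_real S - F / of_real \<gamma>"
      using \<open>0 < S\<close> \<gamma> by (simp add: z_def field_simps)
    finally show ?thesis .
  qed
  then show "0 \<le> Re (cnj (w - of_real G / w) * (\<Sum>i\<in>{0..<N}. ((w + of_real G / w) * u i
           - mat_act N (\<lambda>i j. of_real (((1 / \<gamma>) \<cdot>\<^sub>m (Z - c \<cdot>\<^sub>m 1\<^sub>m N)) $$ (i, j))) u i) * cnj (u i)))"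
    using sum unfolding a_def T_def by simp
qed

text \<open>The constant collects 1 + lam (8 \<gamma> + |c|) as bound for the norm of B = I - lam Z,
  \<kappa>^2 from Cea's lemma, 8 from the norm of D_m(T) and 1/(lam |D|) from the interpolation
  residual. The real point \<open>t\<close> later fixes the sign of the preimage of 1/lam.\<close>

lemma arnoldi_error_bound:
  fixes lam \<gamma> G c \<kappa> :: real
  assumes lam: "0 < lam" and \<gamma>: "0 < \<gamma>" and G: "\<bar>G\<bar> < 1" and \<kappa>: "0 < \<kappa>"
    and supp: "\<And>z w. z \<in> \<Omega> \<Longrightarrow> norm w = 1 \<Longrightarrow>
       0 \<le> Re (cnj (w - of_real G / w) * (w + of_real G / w - (z - of_real c) / of_real \<gamma>))"
    and dist: "\<And>t. of_real t \<in> \<Omega> \<Longrightarrow> \<kappa> \<le> \<bar>1 - lam * t\<bar>"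
    and A: "A \<in> carrier_mat N N"
    and accretive: "field_of_values (map_mat complex_of_real A) \<subseteq> {z. 0 < Re z}"
    and b: "b \<in> carrier_vec N" and b0: "b \<noteq> 0\<^sub>v N"
    and Z_def: "Z = minv (A + lam \<cdot>\<^sub>m 1\<^sub>m N)"
    and fov: "field_of_values (map_mat complex_of_real Z) \<subseteq> \<Omega>"
    and V: "arnoldi_basis Z b m V"
    and D_def: "D = poly (dickson G m) ((1 / lam - c) / \<gamma>)" and D: "D \<noteq> 0"
  shows "\<exists>t < 1 / lam. complex_of_real t \<in> \<Omega>"
    and "euclid_norm (minv A *\<^sub>v b - arnoldi_approx (f_mat lam) Z b V)
      \<le> 8 * (1 + lam * (8 * \<gamma> + \<bar>c\<bar>)) / (\<kappa>\<^sup>2 * lam) * euclid_norm b / \<bar>D\<bar>"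
proof -
  have Apos: "0 < (A *\<^sub>v v) \<bullet> v" if v: "v \<in> carrier_vec N" "v \<noteq> 0\<^sub>v N" for v
  proof -
    have "0 < v \<bullet> v" using scalar_prod_self_ge_0[of v] scalar_prod_self_eq_0[OF v(1)] v(2) by simp
    moreover have "0 < ((A *\<^sub>v v) \<bullet> v) / (v \<bullet> v)"
      using field_of_values_real_mem[OF A v] accretive by force
    ultimately show ?thesis by (simp add: zero_less_divide_iff)
  qed
  define A' where "A' = A + lam \<cdot>\<^sub>m 1\<^sub>m N"
  have A': "A' \<in> carrier_mat N N" using A by (auto simp: A'_def)
  have A'v: "A' *\<^sub>v v = A *\<^sub>v v + lam \<cdot>\<^sub>v v" if v: "v \<in> carrier_vec N" for v
    using A v unfolding A'_def
    by (subst add_mult_distrib_mat_vec[of _ N N]) (auto simp: smult_mat_mult_vec[of _ N N])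
  have mcA: "A *\<^sub>v v \<in> carrier_vec N" if "v \<in> carrier_vec N" for v
    using A that by (rule mult_mat_vec_carrier)
  have injA: "v = 0\<^sub>v N" if "v \<in> carrier_vec N" "A *\<^sub>v v = 0\<^sub>v N" for v
    using Apos[of v] that by fastforce
  have injA': "v = 0\<^sub>v N" if v: "v \<in> carrier_vec N" "A' *\<^sub>v v = 0\<^sub>v N" for v
  proof (rule ccontr)
    assume "v \<noteq> 0\<^sub>v N"
    then have "0 < (A *\<^sub>v v) \<bullet> v + lam * (v \<bullet> v)"
      using Apos[OF v(1)] lam scalar_prod_self_ge_0[of v] by (intro add_pos_nonneg) auto
    also have "\<dots> = (A' *\<^sub>v v) \<bullet> v"
      using v(1) mcA[OF v(1)] by (simp add: A'v add_scalar_prod_distrib[of _ N])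
    finally show False using v by simp
  qed
  have ZA: "Z = minv A'" by (simp add: Z_def A'_def)
  have iA: "minv A \<in> carrier_mat N N" "A * minv A = 1\<^sub>m N"
    by (rule minv_inverse[OF A]; use injA in blast)+
  have iA': "Z \<in> carrier_mat N N" "A' * Z = 1\<^sub>m N" "Z * A' = 1\<^sub>m N"
    unfolding ZA by (rule minv_inverse[OF A']; use injA' in blast)+
  have Z: "Z \<in> carrier_mat N N" by (fact iA'(1))
  have mcZ: "Z *\<^sub>v v \<in> carrier_vec N" if "v \<in> carrier_vec N" for v
    using Z that by (rule mult_mat_vec_carrier)
  have A'Z: "A' *\<^sub>v (Z *\<^sub>v v) = v" if "v \<in> carrier_vec N" for v
    using that assoc_mult_mat_vec[OF A' Z that] by (simp add: iA'(2))
  have ZA': "Z *\<^sub>v (A' *\<^sub>v v) = v" if "v \<in> carrier_vec N" for v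
    using that assoc_mult_mat_vec[OF Z A' that] by (simp add: iA'(3))
  have bb: "0 < b \<bullet> b" using scalar_prod_self_ge_0[of b] scalar_prod_self_eq_0[OF b] b0 by simp

  show "\<exists>t < 1 / lam. complex_of_real t \<in> \<Omega>"
  proof (intro exI conjI)
    \<comment> \<open>The witness is the Rayleigh quotient of \<open>Z\<close> at \<open>b\<close>.
      With b = Au + lam u one gets b.b - lam u.b = |Au|^2 + lam (Au).u, which is positive.\<close>
    define u where "u = Z *\<^sub>v b"
    have u: "u \<in> carrier_vec N" unfolding u_def by (rule mcZ[OF b])
    have bu: "b = A *\<^sub>v u + lam \<cdot>\<^sub>v u" using A'Z[OF b] A'v[OF u] by (simp add: u_def)
    have "A' *\<^sub>v 0\<^sub>v N = 0\<^sub>v N" using A' by (intro eq_vecI) auto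
    then have "u \<noteq> 0\<^sub>v N" using A'Z[OF b] b0 unfolding u_def by metis
    then have "0 < (A *\<^sub>v u) \<bullet> u" by (rule Apos[OF u])
    then have "0 < (A *\<^sub>v u) \<bullet> (A *\<^sub>v u) + lam * ((A *\<^sub>v u) \<bullet> u)"
      using lam scalar_prod_self_ge_0[of "A *\<^sub>v u"] by (intro add_nonneg_pos mult_pos_pos) auto
    also have "\<dots> = b \<bullet> b - lam * (u \<bullet> b)"
      unfolding bu using u mcA[OF u] comm_scalar_prod[OF u mcA[OF u]]
      by (simp add: add_scalar_prod_distrib[of _ N] scalar_prod_add_distrib[of _ N] algebra_simps)
    finally show "(u \<bullet> b) / (b \<bullet> b) < 1 / lam" using bb lam by (simp add: field_simps)
    show "complex_of_real ((u \<bullet> b) / (b \<bullet> b)) \<in> \<Omega>"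
      using field_of_values_real_mem[OF Z b b0] fov unfolding u_def by blast
  qed

  \<comment> \<open>The exact solution satisfies Bx = Zb, and \<open>B\<close> is coercive because
    the real points of \<Omega> stay away from 1/lam.\<close>
  define B where "B = 1\<^sub>m N - lam \<cdot>\<^sub>m Z"
  have B: "B \<in> carrier_mat N N" using Z by (auto simp: B_def)
  have Bv: "B *\<^sub>v v = v - lam \<cdot>\<^sub>v (Z *\<^sub>v v)" if v: "v \<in> carrier_vec N" for v
    using Z v unfolding B_def
    by (subst minus_mult_distrib_mat_vec[of _ N N]) (auto simp: smult_mat_mult_vec[of _ N N])
  have mcB: "B *\<^sub>v v \<in> carrier_vec N" if "v \<in> carrier_vec N" for v
    using B that by (rule mult_mat_vec_carrier)
  have coercive: "\<kappa> * (v \<bullet> v) \<le> \<bar>(B *\<^sub>v v) \<bullet> v\<bar>" if v: "v \<in> carrier_vec N" for v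
  proof (cases "v = 0\<^sub>v N")
    case False
    have vv: "0 < v \<bullet> v" using scalar_prod_self_ge_0[of v] scalar_prod_self_eq_0[OF v] False by simp
    have "(B *\<^sub>v v) \<bullet> v = v \<bullet> v - lam * ((Z *\<^sub>v v) \<bullet> v)"
      using v mcZ[OF v] by (simp add: Bv minus_scalar_prod_distrib[of _ N])
    also have "\<dots> = (1 - lam * (((Z *\<^sub>v v) \<bullet> v) / (v \<bullet> v))) * (v \<bullet> v)"
      using vv by (simp add: field_simps)
    finally have "\<bar>(B *\<^sub>v v) \<bullet> v\<bar> = \<bar>1 - lam * (((Z *\<^sub>v v) \<bullet> v) / (v \<bullet> v))\<bar> * (v \<bullet> v)"
      using vv by (simp add: abs_mult)
    moreover have "\<kappa> \<le> \<bar>1 - lam * (((Z *\<^sub>v v) \<bullet> v) / (v \<bullet> v))\<bar>"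
      using field_of_values_real_mem[OF Z v False] fov by (intro dist) blast
    ultimately show ?thesis using vv by (simp add: mult_right_mono)
  qed simp

  define T where "T = (1 / \<gamma>) \<cdot>\<^sub>m (Z - c \<cdot>\<^sub>m 1\<^sub>m N)"
  have T: "T \<in> carrier_mat N N" using Z by (auto simp: T_def)
  have Tv: "T *\<^sub>v v = (1 / \<gamma>) \<cdot>\<^sub>v (Z *\<^sub>v v - c \<cdot>\<^sub>v v)" if v: "v \<in> carrier_vec N" for v
    unfolding T_def by (rule shift_mat_mult_vec[OF Z v])
  have mcT: "T *\<^sub>v v \<in> carrier_vec N" if "v \<in> carrier_vec N" for v
    using T that by (rule mult_mat_vec_carrier)
  have dn: "euclid_norm (dickson_vec T G v k) \<le> 8 * euclid_norm v" if "v \<in> carrier_vec N" "0 < k" for v k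
    unfolding T_def by (rule dickson_vec_norm_field_of_values[OF Z \<gamma> G that(2) fov supp that(1)])
  define L where "L = 1 + lam * (8 * \<gamma> + \<bar>c\<bar>)"
  have L: "0 \<le> L" using lam \<gamma> by (simp add: L_def)
  \<comment> \<open>Here Z = \<gamma> T + cI, and the norm of T = D_1(T) is at most 8.\<close>
  have normB: "euclid_norm (B *\<^sub>v v) \<le> L * euclid_norm v" if v: "v \<in> carrier_vec N" for v
  proof -
    have eq: "B *\<^sub>v v = v + ((- lam * \<gamma>) \<cdot>\<^sub>v (T *\<^sub>v v) + (- lam * c) \<cdot>\<^sub>v v)"
      using v Z \<gamma> by (intro eq_vecI) (auto simp: Bv Tv field_simps simp del: index_mult_mat_vec)
    have "euclid_norm (B *\<^sub>v v) \<le> euclid_norm v + euclid_norm ((- lam * \<gamma>) \<cdot>\<^sub>v (T *\<^sub>v v) + (- lam * c) \<cdot>\<^sub>v v)"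
      unfolding eq using v mcT[OF v] by (intro euclid_norm_triangle[of _ N]) auto
    also have "euclid_norm ((- lam * \<gamma>) \<cdot>\<^sub>v (T *\<^sub>v v) + (- lam * c) \<cdot>\<^sub>v v)
       \<le> euclid_norm ((- lam * \<gamma>) \<cdot>\<^sub>v (T *\<^sub>v v)) + euclid_norm ((- lam * c) \<cdot>\<^sub>v v)"
      using v mcT[OF v] by (intro euclid_norm_triangle[of _ N]) auto
    also have "\<dots> = lam * \<gamma> * euclid_norm (T *\<^sub>v v) + lam * \<bar>c\<bar> * euclid_norm v"
      unfolding euclid_norm_smult using lam \<gamma> by (simp add: abs_mult)
    also have "lam * \<gamma> * euclid_norm (T *\<^sub>v v) \<le> lam * \<gamma> * (8 * euclid_norm v)"
      using dn[OF v, of 1] lam \<gamma> by (intro mult_left_mono) auto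
    finally show ?thesis by (simp add: L_def algebra_simps)
  qed

  have dimb: "dim_vec b = N" using b by simp
  have m: "0 < m" and Vc: "V \<in> carrier_mat N m" and VV: "transpose_mat V * V = 1\<^sub>m m"
    and V0: "col V 0 = (1 / euclid_norm b) \<cdot>\<^sub>v b"
    and Vspan: "vec_span N {col V j | j. j < m} = krylov Z b m"
    using V unfolding arnoldi_basis_def dimb by auto
  define W where "W = transpose_mat V"
  have W: "W \<in> carrier_mat m N" using Vc by (simp add: W_def)
  have mcV: "V *\<^sub>v v \<in> carrier_vec N" if "v \<in> carrier_vec m" for v
    using Vc that by (rule mult_mat_vec_carrier)
  have mcW: "W *\<^sub>v v \<in> carrier_vec m" if "v \<in> carrier_vec N" for v
    using W that by (rule mult_mat_vec_carrier)
  have WV: "W *\<^sub>v (V *\<^sub>v v) = v" if "v \<in> carrier_vec m" for v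
    using that assoc_mult_mat_vec[OF W Vc that] VV by (simp add: W_def)
  have VW: "(V *\<^sub>v v) \<bullet> w = v \<bullet> (W *\<^sub>v w)" if "v \<in> carrier_vec m" "w \<in> carrier_vec N" for v w
    using transpose_vec_mult_scalar[OF Vc that] mcW[OF that(2)] mcV[OF that(1)] that
    by (simp add: W_def comm_scalar_prod[of _ N] comm_scalar_prod[of _ m])
  define H where "H = W * Z * V"
  have H: "H \<in> carrier_mat m m" using W Z Vc by (auto simp: H_def)
  have mcH: "H *\<^sub>v v \<in> carrier_vec m" if "v \<in> carrier_vec m" for v
    using H that by (rule mult_mat_vec_carrier)
  have Hv: "H *\<^sub>v v = W *\<^sub>v (Z *\<^sub>v (V *\<^sub>v v))" if v: "v \<in> carrier_vec m" for v
    unfolding H_def using v W Z Vc mcV[OF v]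
    by (simp add: assoc_mult_mat_vec[of _ m N _ m] assoc_mult_mat_vec[of _ m N _ N])
  define R where "R = 1\<^sub>m m - lam \<cdot>\<^sub>m H"
  have R: "R \<in> carrier_mat m m" using H by (auto simp: R_def)
  have Rv: "R *\<^sub>v v = v - lam \<cdot>\<^sub>v (H *\<^sub>v v)" if v: "v \<in> carrier_vec m" for v
    using H v unfolding R_def
    by (subst minus_mult_distrib_mat_vec[of _ m m]) (auto simp: smult_mat_mult_vec[of _ m m])
  have Rv': "R *\<^sub>v v = W *\<^sub>v (B *\<^sub>v (V *\<^sub>v v))" if v: "v \<in> carrier_vec m" for v
    using v mcV[OF v] mcZ[OF mcV[OF v]]
    by (simp add: Rv Hv Bv WV mult_minus_distrib_mat_vec[OF W] mult_mat_vec[OF W])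
  \<comment> \<open>As the compression of \<open>B\<close> to the Krylov space, \<open>R\<close>
    inherits coercivity, so f(H_m) involves a genuine inverse.\<close>
  have injR: "v = 0\<^sub>v m" if v: "v \<in> carrier_vec m" "R *\<^sub>v v = 0\<^sub>v m" for v
  proof -
    have "(B *\<^sub>v (V *\<^sub>v v)) \<bullet> (V *\<^sub>v v) = v \<bullet> (R *\<^sub>v v)"
      using VW[OF v(1) mcB[OF mcV[OF v(1)]]] comm_scalar_prod[OF mcB[OF mcV[OF v(1)]] mcV[OF v(1)]]
      by (simp add: Rv'[OF v(1)])
    then have "\<kappa> * ((V *\<^sub>v v) \<bullet> (V *\<^sub>v v)) \<le> 0" using coercive[OF mcV[OF v(1)]] v by simp
    moreover have "(V *\<^sub>v v) \<bullet> (V *\<^sub>v v) = v \<bullet> v"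
      using VW[OF v(1) mcV[OF v(1)]] by (simp add: WV[OF v(1)])
    ultimately have "v \<bullet> v = 0"
      using \<kappa> scalar_prod_self_ge_0[of v] by (simp add: mult_le_0_iff)
    then show ?thesis using scalar_prod_self_eq_0[OF v(1)] by simp
  qed
  have iR: "minv R \<in> carrier_mat m m" "R * minv R = 1\<^sub>m m"
    by (rule minv_inverse[OF R]; use injR in blast)+

  define \<beta> where "\<beta> = euclid_norm b"
  define e0 :: "real vec" where "e0 = unit_vec m 0"
  have e0: "e0 \<in> carrier_vec m" by (simp add: e0_def)
  have \<beta>: "0 < \<beta>" using bb by (simp add: \<beta>_def euclid_norm_def)
  have Ve0: "\<beta> \<cdot>\<^sub>v (V *\<^sub>v e0) = b"
  proof -
    have "V *\<^sub>v e0 = col V 0"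
      unfolding e0_def by (rule mult_mat_unit_vec[OF Vc m])
    then show ?thesis using V0 \<beta> b by (auto simp: \<beta>_def smult_smult_assoc)
  qed
  define s where "s = minv R * H *\<^sub>v e0"
  have s: "s \<in> carrier_vec m" unfolding s_def using iR(1) H e0 by (auto intro!: mult_mat_vec_carrier[of _ m m])
  have Rs: "R *\<^sub>v s = H *\<^sub>v e0"
  proof -
    have "R *\<^sub>v s = (R * minv R) *\<^sub>v (H *\<^sub>v e0)"
      unfolding s_def using R iR(1) H e0 mcH[OF e0] by (simp add: assoc_mult_mat_vec[of _ m m _ m])
    then show ?thesis using mcH[OF e0] iR(2) by simp
  qed
  define xm where "xm = arnoldi_approx (f_mat lam) Z b V"
  have xm: "xm = \<beta> \<cdot>\<^sub>v (V *\<^sub>v s)"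
    using H Vc unfolding xm_def arnoldi_approx_def Let_def f_mat_def s_def R_def
    by (simp add: e0_def \<beta>_def flip: W_def H_def)
  have xmc: "xm \<in> carrier_vec N" unfolding xm using mcV[OF s] by simp
  define x where "x = minv A *\<^sub>v b"
  have x: "x \<in> carrier_vec N" unfolding x_def using iA(1) b by (rule mult_mat_vec_carrier)
  have Ax: "A *\<^sub>v x = b"
    unfolding x_def using assoc_mult_mat_vec[OF A iA(1) b] b by (simp add: iA(2))
  have Bx: "B *\<^sub>v x = Z *\<^sub>v b"
  proof -
    have eq: "Z *\<^sub>v b + lam \<cdot>\<^sub>v (Z *\<^sub>v x) = x"
      using ZA'[OF x] A'v[OF x] x b by (simp add: Ax mult_add_distrib_mat_vec[OF Z] mult_mat_vec[OF Z])
    have "x $ i = (Z *\<^sub>v b) $ i + lam * (Z *\<^sub>v x) $ i" if "i < N" for i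
      using arg_cong[OF eq, of "\<lambda>v :: real vec. v $ i"] that Z by (simp del: index_mult_mat_vec)
    then show ?thesis
      using Z x unfolding Bv[OF x] by (intro eq_vecI) (auto simp del: index_mult_mat_vec)
  qed
  define e where "e = x - xm"
  have e: "e \<in> carrier_vec N" using x xmc by (simp add: e_def)
  \<comment> \<open>The Galerkin condition: R s = H e_1 says that the residual of \<open>xm\<close>
    is orthogonal to the columns of \<open>V\<close>.\<close>
  have WBe: "W *\<^sub>v (B *\<^sub>v e) = 0\<^sub>v m"
  proof -
    have "W *\<^sub>v (B *\<^sub>v e) = W *\<^sub>v (Z *\<^sub>v b) - \<beta> \<cdot>\<^sub>v (R *\<^sub>v s)"
      using x xmc mcV[OF s] mcB[OF mcV[OF s]] mcZ[OF b]
      unfolding e_def by (simp add: mult_minus_distrib_mat_vec[OF B] Bx xm mult_mat_vec[OF B]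
         mult_minus_distrib_mat_vec[OF W] mult_mat_vec[OF W] Rv'[OF s])
    also have "W *\<^sub>v (Z *\<^sub>v b) = \<beta> \<cdot>\<^sub>v (H *\<^sub>v e0)"
      using mcV[OF e0] mcZ[OF mcV[OF e0]]
      by (simp add: mult_mat_vec[OF Z] mult_mat_vec[OF W] Hv[OF e0] flip: Ve0)
    finally show ?thesis using mcH[OF e0] by (simp add: Rs)
  qed
  define r where "r = B *\<^sub>v e"
  have r: "r \<in> carrier_vec N" unfolding r_def by (rule mcB[OF e])
  have rV: "r \<bullet> (V *\<^sub>v v) = 0" if "v \<in> carrier_vec m" for v
    using VW[OF that r] that comm_scalar_prod[OF r mcV[OF that]] by (simp add: r_def WBe)
  have rcol: "r \<bullet> col V j = 0" if "j < m" for j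
    using rV[of "unit_vec m j"] mult_mat_unit_vec[OF Vc that] by simp
  have orth: "r \<bullet> ((Z ^\<^sub>m i) *\<^sub>v b) = 0" if "i < m" for i
  proof (rule vec_span_orthogonal[OF _ r])
    show "{col V j |j. j < m} \<subseteq> carrier_vec N" using Vc by auto
    show "(Z ^\<^sub>m i) *\<^sub>v b \<in> vec_span N {col V j |j. j < m}"
      unfolding Vspan krylov_def dimb
    proof (rule vec_span_mem)
      show "{(Z ^\<^sub>m j) *\<^sub>v b |j. j < m} \<subseteq> carrier_vec N"
        using pow_carrier_mat[OF Z] b by (auto intro: mult_mat_vec_carrier)
    qed (use that in blast)
  qed (use rcol in blast)

  define \<zeta> where "\<zeta> = (1 / lam - c) / \<gamma>"
  define q where "q = dickson_quot_vec T G \<zeta> b m"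
  define p where "p = dickson_vec T G b m"
  have q: "q \<in> carrier_vec N" unfolding q_def using T b by simp
  have p: "p \<in> carrier_vec N" unfolding p_def using T b by simp
  have rq: "r \<bullet> q = 0"
    using dickson_quot_vec_orthogonal[OF Z b r T_def orth, where n = m and i = 0 and G = G and \<zeta> = \<zeta>] q Z
    by (simp add: q_def)
  have rb: "r \<bullet> b = 0" using orth[OF m] Z b by simp
  have qp: "\<zeta> \<cdot>\<^sub>v q - T *\<^sub>v q = D \<cdot>\<^sub>v b - p"
    unfolding q_def p_def D_def \<zeta>_def by (rule dickson_quot_vec[OF T b])
  \<comment> \<open>The subtracted vector is the interpolant of f. With \<tau> = (z - c)/\<gamma>
    one has 1 - lam z = lam \<gamma> (\<zeta> - \<tau>), and 1/(\<zeta> - \<tau>) is replaced by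
    q_m(\<tau>)/D in f(z) = ((1 - lam z)^{-1} - 1)/lam.\<close>
  define h where "h = x - ((1 / (lam * lam * \<gamma> * D)) \<cdot>\<^sub>v q - (1 / lam) \<cdot>\<^sub>v b)"
  have h: "h \<in> carrier_vec N" using x q b by (simp add: h_def)
  have reh: "r \<bullet> e = r \<bullet> h"
  proof -
    have "r \<bullet> xm = 0" using rV[OF s] r mcV[OF s] by (simp add: xm)
    then have "r \<bullet> e = r \<bullet> x" using r x xmc by (simp add: e_def scalar_prod_minus_distrib[of _ N])
    moreover have "r \<bullet> h = r \<bullet> x"
      using r x q b rq rb by (simp add: h_def scalar_prod_minus_distrib[of _ N])
    ultimately show ?thesis by simp
  qed
  have Bh: "B *\<^sub>v h = (1 / (lam * D)) \<cdot>\<^sub>v p"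
  proof -
    \<comment> \<open>The matrix form of 1 - lam z = lam \<gamma> (\<zeta> - \<tau>), combined with
      \<open>qp\<close>.\<close>
    have Bq: "B *\<^sub>v q = (lam * \<gamma>) \<cdot>\<^sub>v (D \<cdot>\<^sub>v b - p)"
      unfolding qp[symmetric] using q Z \<gamma> lam
      by (intro eq_vecI) (auto simp: Bv Tv \<zeta>_def field_simps simp del: index_mult_mat_vec)
    have "B *\<^sub>v h = Z *\<^sub>v b - ((1 / (lam * lam * \<gamma> * D)) \<cdot>\<^sub>v ((lam * \<gamma>) \<cdot>\<^sub>v (D \<cdot>\<^sub>v b - p)) - (1 / lam) \<cdot>\<^sub>v (b - lam \<cdot>\<^sub>v (Z *\<^sub>v b)))"
      using x q b by (simp add: h_def mult_minus_distrib_mat_vec[OF B] mult_mat_vec[OF B] Bx Bq flip: Bv[OF b])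
    also have "\<dots> = (1 / (lam * D)) \<cdot>\<^sub>v p"
      using Z b p lam \<gamma> D
      by (intro eq_vecI) (auto simp: field_simps simp del: index_mult_mat_vec)
    finally show ?thesis .
  qed
  have "euclid_norm e \<le> L / \<kappa>\<^sup>2 * euclid_norm (B *\<^sub>v h)"
    by (rule cea[OF e h B \<kappa> L coercive normB[OF e]]) (use reh in \<open>simp_all add: r_def\<close>)
  also have "euclid_norm (B *\<^sub>v h) = 1 / (lam * \<bar>D\<bar>) * euclid_norm p"
    using lam by (simp add: Bh euclid_norm_smult abs_mult)
  also have "L / \<kappa>\<^sup>2 * (1 / (lam * \<bar>D\<bar>) * euclid_norm p) \<le> L / \<kappa>\<^sup>2 * (1 / (lam * \<bar>D\<bar>) * (8 * euclid_norm b))"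
    unfolding p_def using L lam by (intro mult_left_mono dn[OF b m]) auto
  finally show "euclid_norm (minv A *\<^sub>v b - arnoldi_approx (f_mat lam) Z b V)
      \<le> 8 * (1 + lam * (8 * \<gamma> + \<bar>c\<bar>)) / (\<kappa>\<^sup>2 * lam) * euclid_norm b / \<bar>D\<bar>"
    by (simp add: e_def x_def xm_def L_def mult_ac)
qed

section \<open>The pole of f and the final estimate\<close>

lemma f_fun_pole:
  assumes "0 < lam" "f_fun lam analytic_on \<Omega>"
  shows "complex_of_real (1 / lam) \<notin> \<Omega>"
proof
  let ?z = "complex_of_real (1 / lam)"
  assume "?z \<in> \<Omega>"
  then have "f_fun lam analytic_on {?z}" by (intro analytic_on_subset[OF assms(2)]) simp
  then have "isCont (f_fun lam) ?z" by (rule analytic_at_imp_isCont)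
  \<comment> \<open>As \<open>inverse 0 = 0\<close>, the function has the value 0 at its pole, so
    the contradiction must come from continuity: f(z)(1 - lam z) would tend to 0, yet it equals z
    nearby.\<close>
  then have "(f_fun lam \<longlongrightarrow> f_fun lam ?z) (at ?z)" by (simp add: isCont_def)
  then have "((\<lambda>z. f_fun lam z * (1 - of_real lam * z)) \<longlongrightarrow> f_fun lam ?z * (1 - of_real lam * ?z)) (at ?z)"
    by (intro tendsto_intros)
  then have "((\<lambda>z. f_fun lam z * (1 - of_real lam * z)) \<longlongrightarrow> 0) (at ?z)"
    using assms(1) by simp
  moreover have "\<forall>\<^sub>F z in at ?z. f_fun lam z * (1 - of_real lam * z) = z"
    unfolding eventually_at_filter
  proof (intro always_eventually allI impI)
    fix z assume "z \<noteq> ?z"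
    then have "1 - of_real lam * z \<noteq> 0" using assms(1) by (auto simp: field_simps)
    then show "f_fun lam z * (1 - of_real lam * z) = z" by (simp add: f_fun_def)
  qed
  ultimately have "((\<lambda>z. z) \<longlongrightarrow> 0) (at ?z)" by (rule Lim_transform_eventually)
  then have "0 = ?z" by (rule tendsto_unique[OF at_neq_bot _ tendsto_ident_at])
  then show False using assms(1) by simp
qed

theorem theorem4:
  fixes lam \<beta> :: real and \<Omega> :: "complex set" and \<psi> :: "complex \<Rightarrow> complex"
  assumes "0 < lam"
    and "filled_ellipse \<Omega>"
    and "cnj ` \<Omega> = \<Omega>"
    and "f_fun lam analytic_on \<Omega>"
    and "exterior_conformal_map \<Omega> \<psi>"
  shows "\<forall>\<^sub>F m in sequentially. \<forall>N A b V.
    A \<in> carrier_mat N N \<longrightarrow>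
    field_of_values (map_mat complex_of_real A) \<subseteq> {z. 0 < Re z} \<longrightarrow>
    b \<in> carrier_vec N \<longrightarrow> b \<noteq> 0\<^sub>v N \<longrightarrow> euclid_norm b = \<beta> \<longrightarrow>
    (let Z = minv (A + lam \<cdot>\<^sub>m 1\<^sub>m N);
         x = minv A *\<^sub>v b;
         x\<^sub>m = arnoldi_approx (f_mat lam) Z b V;
         \<phi> = exterior_inverse \<psi>;
         r = Re (\<phi> (of_real (1 / lam)));
         d = Re (deriv \<psi> (of_real r));
         K = 1 / lam\<^sup>2;
         C = (if transpose_mat A = A then 1 else 11.08)
     in field_of_values (map_mat complex_of_real Z) \<subseteq> \<Omega> \<longrightarrow>
        arnoldi_basis Z b m V \<longrightarrow>
        euclid_norm (x - x\<^sub>m)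
          \<le> 4 * exp 1 * C * (r / (r - 1)) * (1 / d) * K * ((real m + 1) / r ^ m))"
proof -
  note lam = assms(1)
  obtain \<gamma> G c :: real where \<gamma>: "0 < \<gamma>" and G: "\<bar>G\<bar> < 1" and c\<Omega>: "of_real c \<in> \<Omega>"
    and conv: "convex \<Omega>" and clo: "closed \<Omega>"
    and \<psi>: "\<And>w. 1 < norm w \<Longrightarrow> \<psi> w = of_real \<gamma> * (w + of_real G / w) + of_real c"
    and supp: "\<And>z w. z \<in> \<Omega> \<Longrightarrow> norm w = 1 \<Longrightarrow>
       0 \<le> Re (cnj (w - of_real G / w) * (w + of_real G / w - (z - of_real c) / of_real \<gamma>))"
    using ellipse_exterior_map[OF assms(2,3,5)] by metis
  have pole: "complex_of_real (1 / lam) \<notin> \<Omega>" by (rule f_fun_pole[OF lam assms(4)])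
  \<comment> \<open>The distance of the pole from \<Omega> gives the coercivity constant \<kappa> =
    lam \<delta>, which is independent of the matrix.\<close>
  obtain \<delta> where \<delta>: "0 < \<delta>" "\<And>z. z \<in> \<Omega> \<Longrightarrow> \<delta> \<le> dist (complex_of_real (1 / lam)) z"
    using separate_point_closed[OF clo pole] by blast
  define \<kappa> where "\<kappa> = lam * \<delta>"
  have \<kappa>: "0 < \<kappa>" using lam \<delta>(1) by (simp add: \<kappa>_def)
  have kdist: "\<kappa> \<le> \<bar>1 - lam * t\<bar>" if "of_real t \<in> \<Omega>" for t
  proof -
    have "\<delta> \<le> \<bar>1 / lam - t\<bar>"
      using \<delta>(2)[OF that] by (simp only: dist_norm norm_of_real flip: of_real_diff)
    then have "\<kappa> \<le> lam * \<bar>1 / lam - t\<bar>" using lam by (simp add: \<kappa>_def)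
    also have "\<dots> = \<bar>lam * (1 / lam - t)\<bar>" using lam by (simp only: abs_mult abs_of_pos)
    also have "lam * (1 / lam - t) = 1 - lam * t" using lam by (simp add: field_simps)
    finally show ?thesis .
  qed
  define w0 where "w0 = exterior_inverse \<psi> (complex_of_real (1 / lam))"
  define r where "r = Re w0"
  have im: "\<psi> ` {w. 1 < norm w} = - \<Omega>" and inj: "inj_on \<psi> {w. 1 < norm w}"
    using assms(5) unfolding exterior_conformal_map_def by auto
  have w0: "1 < norm w0" "\<psi> w0 = complex_of_real (1 / lam)"
    using inv_into_into[of "complex_of_real (1 / lam)" \<psi> "{w. 1 < norm w}"]
      f_inv_into_f[of "complex_of_real (1 / lam)" \<psi> "{w. 1 < norm w}"] pole im
    by (auto simp: w0_def exterior_inverse_def)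
  \<comment> \<open>The coefficients of \<psi> are real and \<psi> is injective, so the preimage of
    a real point is real.\<close>
  have "\<psi> (cnj w0) = cnj (\<psi> w0)" using w0(1) by (simp add: \<psi>)
  then have "\<psi> (cnj w0) = \<psi> w0" by (simp add: w0(2))
  then have "cnj w0 = w0" using inj w0(1) by (auto dest: inj_onD)
  then have w0r: "w0 = of_real r" by (simp add: r_def complex_eq_iff)
  have r1: "1 < \<bar>r\<bar>" using w0(1) w0r by simp
  have "complex_of_real (1 / lam) = complex_of_real (\<gamma> * (r + G / r) + c)"
    using w0 \<psi>[OF w0(1)] by (simp add: w0r)
  then have lr: "1 / lam = \<gamma> * (r + G / r) + c" by (simp only: of_real_eq_iff)
  define \<zeta> where "\<zeta> = (1 / lam - c) / \<gamma>"
  have \<zeta>: "\<zeta> = r + G / r" using \<gamma> by (simp add: \<zeta>_def lr)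
  define d where "d = Re (deriv \<psi> (of_real r))"
  have Gr2: "\<bar>G / r\<^sup>2\<bar> < 1"
  proof -
    have "1 < r\<^sup>2" using r1 by (metis one_less_power power2_abs zero_less_numeral)
    then show ?thesis using G by (simp add: abs_divide divide_less_eq)
  qed
  have d: "0 < d"
  proof -
    have r0: "complex_of_real r \<noteq> 0" using r1 by auto
    have "((\<lambda>w. of_real \<gamma> * (w + of_real G / w) + of_real c) has_field_derivative
       of_real \<gamma> * (1 - of_real G / (of_real r)\<^sup>2)) (at (complex_of_real r))"
      using r0 by (auto intro!: derivative_eq_intros simp: power2_eq_square)
    moreover have "\<forall>\<^sub>F w in nhds (complex_of_real r). of_real \<gamma> * (w + of_real G / w) + of_real c = \<psi> w"
    proof (rule eventually_mono)
      show "\<forall>\<^sub>F w in nhds (complex_of_real r). w \<in> {w. 1 < norm w}"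
        by (rule eventually_nhds_in_open) (use r1 in \<open>auto intro!: open_Collect_less continuous_intros\<close>)
    qed (simp add: \<psi>)
    ultimately have "(\<psi> has_field_derivative of_real \<gamma> * (1 - of_real G / (of_real r)\<^sup>2)) (at (complex_of_real r))"
      by (subst DERIV_cong_ev[OF refl _ refl, symmetric])
    then have "deriv \<psi> (of_real r) = of_real (\<gamma> * (1 - G / r\<^sup>2))" by (simp add: DERIV_imp_deriv)
    then have "d = \<gamma> * (1 - G / r\<^sup>2)" by (simp only: d_def Re_complex_of_real)
    moreover have "0 < 1 - G / r\<^sup>2" using Gr2 by linarith
    ultimately show ?thesis using \<gamma> by simp
  qed
  \<comment> \<open>A negative r puts 1/lam to the left of the centre \<open>c\<close>; being to the
    right of \<open>t\<close>, it would lie on a segment inside the convex \<Omega>.\<close>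
  have neg: False if rneg: "r < 0" and t: "t < 1 / lam" "complex_of_real t \<in> \<Omega>" for t
  proof -
    have "\<zeta> = r * (1 + G / r\<^sup>2)" using r1 by (simp add: \<zeta> field_simps power2_eq_square)
    also have "0 < 1 + G / r\<^sup>2" using Gr2 by linarith
    then have "r * (1 + G / r\<^sup>2) < 0" using rneg by (rule mult_neg_pos[rotated])
    finally have "1 / lam < c" using \<gamma> by (simp add: \<zeta>_def divide_less_0_iff)
    then have "1 / lam \<in> closed_segment t c"
      using t(1) by (simp add: closed_segment_eq_real_ivl)
    then have "complex_of_real (1 / lam) \<in> closed_segment (of_real t) (of_real c)"
      unfolding closed_segment_of_real by (rule imageI)
    then show False using pole closed_segment_subset[OF t(2) c\<Omega> conv] by blast
  qed
  \<comment> \<open>\<open>Q * (r / (r - 1)) / r ^ m\<close> will bound the error, and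
    \<open>M * (real m + 1) / r ^ m\<close> is the claimed bound without the factor C. Both
    constants depend only on \<open>lam\<close>, \<Omega>, \<psi> and \<beta>, so the threshold for
    m is uniform.\<close>
  define Q where "Q = 8 * (1 + lam * (8 * \<gamma> + \<bar>c\<bar>)) / (\<kappa>\<^sup>2 * lam) * \<beta>"
  define M where "M = 4 * exp 1 * (r / (r - 1)) * (1 / d) * (1 / lam\<^sup>2)"
  have ev: "\<forall>\<^sub>F m in sequentially. 0 < m \<and> Q * (r / (r - 1)) \<le> M * (real m + 1)" if "1 < r"
  proof -
    have M: "0 < M" unfolding M_def using that d lam by simp
    have "filterlim (\<lambda>m. M * (real m + 1)) at_top sequentially"
      using M by real_asymp
    then have "\<forall>\<^sub>F m in sequentially. Q * (r / (r - 1)) \<le> M * (real m + 1)"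
      by (simp add: filterlim_at_top)
    then show ?thesis using eventually_gt_at_top[of 0] by eventually_elim simp
  qed
  \<comment> \<open>That r is positive becomes known only once a matrix \<open>A\<close> is given,
    since \<open>A\<close> supplies the point \<open>t\<close>; the threshold is therefore chosen
    conditionally.\<close>
  have "\<forall>\<^sub>F m in sequentially. 1 < r \<longrightarrow> 0 < m \<and> Q * (r / (r - 1)) \<le> M * (real m + 1)"
    using ev by (cases "1 < r") auto
  then show ?thesis
  proof eventually_elim
    case (elim m)
    show ?case
    proof (intro allI impI, unfold Let_def, intro impI)
      fix N :: nat and A :: "real mat" and b :: "real vec" and V :: "real mat"
      assume A: "A \<in> carrier_mat N N"
        and acc: "field_of_values (map_mat complex_of_real A) \<subseteq> {z. 0 < Re z}"
        and b: "b \<in> carrier_vec N" "b \<noteq> 0\<^sub>v N" and nb: "euclid_norm b = \<beta>"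
        and fov: "field_of_values (map_mat complex_of_real (minv (A + lam \<cdot>\<^sub>m 1\<^sub>m N))) \<subseteq> \<Omega>"
        and V: "arnoldi_basis (minv (A + lam \<cdot>\<^sub>m 1\<^sub>m N)) b m V"
      define C :: real where "C = (if transpose_mat A = A then 1 else 11.08)"
      define D where "D = poly (dickson G m) \<zeta>"
      have bound: "\<exists>t < 1 / lam. complex_of_real t \<in> \<Omega>"
        "euclid_norm (minv A *\<^sub>v b - arnoldi_approx (f_mat lam) (minv (A + lam \<cdot>\<^sub>m 1\<^sub>m N)) b V)
          \<le> 8 * (1 + lam * (8 * \<gamma> + \<bar>c\<bar>)) / (\<kappa>\<^sup>2 * lam) * euclid_norm b / \<bar>D\<bar>" if "D \<noteq> 0"
        by (rule arnoldi_error_bound[OF lam \<gamma> G \<kappa> supp kdist A acc b refl fov V _ that];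
            simp add: D_def \<zeta>_def)+
      have Dr: "D = r ^ m + (G / r) ^ m" unfolding D_def \<zeta> by (rule poly_dickson) (use r1 in auto)
      have m: "0 < m" using V by (simp add: arnoldi_basis_def)
      have Gr: "\<bar>(G / r) ^ m\<bar> < 1"
      proof -
        have "\<bar>G / r\<bar> < 1" using G r1 by (simp add: abs_divide divide_less_eq)
        then show ?thesis using m by (simp add: power_abs power_less_one_iff)
      qed
      have rm: "\<bar>r\<bar> \<le> \<bar>r ^ m\<bar>" using r1 m by (simp add: power_abs self_le_power)
      have D0: "D \<noteq> 0" using Gr rm r1 unfolding Dr by linarith
      have r: "1 < r" using neg bound(1)[OF D0] r1 by (cases "r < 0") auto
      \<comment> \<open>D exceeds r^m - 1, and 1 \<le> r^(m-1) because m is positive; this is the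
        source of the factor r/(r - 1).\<close>
      have "r ^ m * (1 - 1 / r) \<le> \<bar>D\<bar>"
      proof -
        have "r ^ m * (1 - 1 / r) = r ^ m - r ^ m / r" by (simp add: algebra_simps)
        moreover have "1 \<le> r ^ m / r" using rm r by simp
        ultimately show ?thesis using Gr unfolding Dr by linarith
      qed
      moreover have "0 < r ^ m * (1 - 1 / r)" using r by simp
      ultimately have "1 / \<bar>D\<bar> \<le> 1 / (r ^ m * (1 - 1 / r))" by (intro divide_left_mono) auto
      also have "\<dots> = r / (r - 1) / r ^ m" using r by (simp add: field_simps)
      finally have Dle: "1 / \<bar>D\<bar> \<le> r / (r - 1) / r ^ m" .
      have "0 \<le> \<beta>" using euclid_norm_ge_0[of b] nb by simp
      then have Q: "0 \<le> Q" using lam \<gamma> by (simp add: Q_def)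
      have "euclid_norm (minv A *\<^sub>v b - arnoldi_approx (f_mat lam) (minv (A + lam \<cdot>\<^sub>m 1\<^sub>m N)) b V) \<le> Q * (1 / \<bar>D\<bar>)"
        using bound(2)[OF D0] by (simp add: nb Q_def)
      also have "\<dots> \<le> Q * (r / (r - 1) / r ^ m)" using Dle Q by (rule mult_left_mono)
      also have "\<dots> = Q * (r / (r - 1)) / r ^ m" by simp
      also have "\<dots> \<le> M * (real m + 1) / r ^ m"
        using elim r by (intro divide_right_mono) auto
      \<comment> \<open>Both values of C are at least 1.\<close>
      also have "\<dots> \<le> C * (M * (real m + 1) / r ^ m)"
      proof -
        have "0 \<le> M * (real m + 1) / r ^ m" unfolding M_def using r d lam by simp
        moreover have "1 \<le> C" by (simp add: C_def)
        ultimately show ?thesis using mult_right_mono[of 1 C] by (simp only: mult_1)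
      qed
      also have "\<dots> = 4 * exp 1 * C * (r / (r - 1)) * (1 / d) * (1 / lam\<^sup>2) * ((real m + 1) / r ^ m)"
        by (simp add: M_def)
      finally show "euclid_norm (minv A *\<^sub>v b - arnoldi_approx (f_mat lam) (minv (A + lam \<cdot>\<^sub>m 1\<^sub>m N)) b V)
         \<le> 4 * exp 1 * (if transpose_mat A = A then 1 else 11.08) *
           (Re (exterior_inverse \<psi> (of_real (1 / lam))) / (Re (exterior_inverse \<psi> (of_real (1 / lam))) - 1)) *
           (1 / Re (deriv \<psi> (of_real (Re (exterior_inverse \<psi> (of_real (1 / lam))))))) * (1 / lam\<^sup>2) *
           ((real m + 1) / Re (exterior_inverse \<psi> (of_real (1 / lam))) ^ m)"
        unfolding C_def d_def r_def w0_def .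
    qed
  qed
qed

end
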